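(* Assume $\alpha\ge1$, $\alpha\ne2$, $m_1=1$, and that the primaries are in a relative equilibrium $q_j(t)=e^{Jt}a_j$, $j=1,\dots,n$, where $a_j\in\mathbb R^2$ satisfy $a_j=\sum_{k\neq j}m_k\frac{a_j-a_k}{\|a_j-a_k\|^{\alpha+1}}$. For each positive integer $\mathfrak q$ there is an integer $\mathfrak r_0$ such that for each integer $\mathfrak r>\mathfrak r_0$ the restricted $(n+1)$-body problem has at least two $2\pi\mathfrak q$-periodic solutions of the form $$q(t)=q_1(t)+\varepsilon e^{J(\theta_j+\mathfrak r t/\mathfrak q)}x_0+\mathcal O(\varepsilon^3),\qquad \varepsilon=(\mathfrak r/\mathfrak q)^{-2/(\alpha+1)},\quad j=1,2,$$ where $\theta_j\in[0,2\pi]$ and $\mathcal O(\varepsilon^3)$ is a $2\pi\mathfrak q$-periodic function of order $\varepsilon^3$.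
   Context: Masses $m_1,\dots,m_n>0$, $n\ge2$. The restricted $(n+1)$-body problem is the equation $\ddot q(t)=-\sum_{j=1}^n m_j\frac{q(t)-q_j(t)}{\|q(t)-q_j(t)\|^{\alpha+1}}$ for $q:\mathbb R\to\mathbb R^2$, where $q_j$ are the positions of the primaries. $J=\begin{pmatrix}0&1\\-1&0\end{pmatrix}$, $e^{J\theta}=\cos\theta\,I+\sin\theta\,J$, $x_0=(1,0)^T$, $\|\cdot\|$ the Euclidean norm. *)

theory Defs
  imports "HOL-Analysis.Analysis"
begin

definition Jmat :: "real^2^2" where
  "Jmat = vector [vector [0, 1], vector [-1, 0]]"

definition expJ :: "real \<Rightarrow> real^2^2" where
  "expJ \<theta> = cos \<theta> *\<^sub>R mat 1 + sin \<theta> *\<^sub>R Jmat"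

definition x0 :: "real^2" where
  "x0 = vector [1, 0]"

definition primary :: "(nat \<Rightarrow> real^2) \<Rightarrow> nat \<Rightarrow> real \<Rightarrow> real^2" where
  "primary a j t = expJ t *v a j"

definition central_config :: "nat \<Rightarrow> (nat \<Rightarrow> real) \<Rightarrow> real \<Rightarrow> (nat \<Rightarrow> real^2) \<Rightarrow> bool" where
  "central_config n m \<alpha> a \<longleftrightarrow>
     (\<forall>j\<in>{1..n}. a j = (\<Sum>k\<in>{1..n} - {j}.
        (m k / norm (a j - a k) powr (\<alpha> + 1)) *\<^sub>R (a j - a k)))"

definition restricted_solution ::
  "nat \<Rightarrow> (nat \<Rightarrow> real) \<Rightarrow> real \<Rightarrow> (nat \<Rightarrow> real \<Rightarrow> real^2) \<Rightarrow> (real \<Rightarrow> real^2) \<Rightarrow> bool" where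
  "restricted_solution n m \<alpha> qp q \<longleftrightarrow>
     (\<forall>t. \<forall>j\<in>{1..n}. q t \<noteq> qp j t) \<and>
     (\<exists>v. \<forall>t. (q has_vector_derivative v t) (at t) \<and>
        (v has_vector_derivative
           (- (\<Sum>j\<in>{1..n}. (m j / norm (q t - qp j t) powr (\<alpha> + 1)) *\<^sub>R (q t - qp j t)))) (at t))"

end

theory Submission
  imports Defs
begin

text \<open>
  In the frame rotating with the primaries the problem is autonomous, so one nonconstant periodic solution
  near the first primary yields others by translating time; the translations by \<open>0\<close> and by half a revolution
  are used. With \<open>\<omega> = r / qq\<close> and \<open>s = (\<omega> - 1) t + \<theta>\<close>, write
  \<open>q - q\<^sub>1 = \<epsilon> e\<^bsup>i(\<omega> t + \<theta>)\<^esup> z(s)\<close>. The equation becomes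
  \<open>\<nu>\<^sup>2 z'' + 2 i \<nu> z' = z - z |z|\<^bsup>-(\<alpha> + 1)\<^esup> + P(s, z)\<close> with \<open>\<nu> = 1 - 1 / \<omega>\<close>, where the tidal term \<open>P\<close> has size
  and Lipschitz constant of order \<open>\<epsilon>\<^bsup>\<alpha> + 1\<^esup>\<close>, hence of order \<open>\<epsilon>\<^sup>2\<close> at most.

  The linearisation at \<open>z = 1\<close> on \<open>2\<pi>\<close>-periodic functions has as kernel only the imaginary constants:
  the radial oscillations have squared frequency \<open>3 - \<alpha>\<close>, which is the square of a nonzero integer only
  for \<open>\<alpha> = 2\<close>. A contraction therefore solves the equation up to a constant imaginary residual force, and
  conservation of the Jacobi integral over one period forces that residual to vanish.
\<close>

section \<open>Periodic functions and periodic convolution\<close>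

text \<open>The obstacle is degeneracy: for \<open>P = 0\<close> every constant \<open>z\<close> of
  modulus 1 is a solution, so \<open>z = 1\<close> is not isolated and the linearisation cannot be
  inverted. The imaginary constants in its kernel are this phase direction. The approximate inverse
  used here selects corrections whose imaginary part has mean zero, which pins down the phase and
  leaves one scalar residual.

  The circular orbit \<open>z = 1\<close> solves the equation with \<open>P = 0\<close> exactly for
  every \<nu>. Hence the correction is controlled by the tidal term alone, and letting \<nu> vary
  costs nothing in the error; it only has to be close enough to 1 for estimates that are uniform in
  \<nu>. The value of \<epsilon> is Kepler's third law for a circular orbit of angular speed
  \<omega>. The deviation of order \<open>\<epsilon>\<^sup>2\<close> in \<open>z\<close> becomes
  \<open>\<epsilon>\<^sup>3\<close> through the prefactor \<epsilon>.

  The fixed point is sought in the sup norm, among functions that are merely continuous. All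
  derivatives are recovered afterwards, because the fixed point is expressed by convolutions with
  explicit kernels.\<close>

definition periodic_cont :: "(real \<Rightarrow> 'a::topological_space) \<Rightarrow> bool" where
  "periodic_cont f \<longleftrightarrow> continuous_on UNIV f \<and> (\<forall>s. f (s + 2 * pi) = f s)"

lemma periodic_contD:
  assumes "periodic_cont f"
  shows "continuous_on S f" "f (s + 2 * pi) = f s"
  using assms continuous_on_subset unfolding periodic_cont_def by blast+

lemma periodic_cont_minus_period:
  assumes "periodic_cont f"
  shows "f (s - 2 * pi) = f s"
  using periodic_contD(2)[OF assms, of "s - 2 * pi"] by simp

lemma periodic_contI:
  assumes "continuous_on UNIV f" "\<And>s. f (s + 2 * pi) = f s"
  shows "periodic_cont f"
  using assms unfolding periodic_cont_def by blast

text \<open>The complete space is a ball of continuous periodic functions in the sup norm. The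
  hypotheses speak of plain functions, so that the operators constructed below need not be lifted to
  the type of bounded continuous functions.\<close>

lemma banach_fix_periodic:
  fixes T :: "(real \<Rightarrow> 'a::banach) \<Rightarrow> real \<Rightarrow> 'a"
  assumes "0 \<le> \<rho>"
    and per: "\<And>f. periodic_cont f \<Longrightarrow> (\<And>s. norm (f s) \<le> \<rho>) \<Longrightarrow> periodic_cont (T f)"
    and bound: "\<And>f s. periodic_cont f \<Longrightarrow> (\<And>s. norm (f s) \<le> \<rho>) \<Longrightarrow> norm (T f s) \<le> \<rho>"
    and contr: "\<And>f g d s. periodic_cont f \<Longrightarrow> (\<And>s. norm (f s) \<le> \<rho>) \<Longrightarrow> periodic_cont g \<Longrightarrow>
      (\<And>s. norm (g s) \<le> \<rho>) \<Longrightarrow> (\<And>s. norm (f s - g s) \<le> d) \<Longrightarrow> norm (T f s - T g s) \<le> d / 2"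
  obtains f where "periodic_cont f" "\<And>s. norm (f s) \<le> \<rho>" "T f = f"
proof -
  define S where "S = {u :: real \<Rightarrow>\<^sub>C 'a. periodic_cont (apply_bcontfun u) \<and> (\<forall>s. norm (apply_bcontfun u s) \<le> \<rho>)}"
  have inS: "Bcontfun f \<in> S \<and> apply_bcontfun (Bcontfun f) = f"
    if "periodic_cont f" "\<And>s. norm (f s) \<le> \<rho>" for f :: "real \<Rightarrow> 'a"
  proof -
    have "f \<in> bcontfun"
      using that by (intro bcontfun_normI[where b = \<rho>]) (auto intro: periodic_contD)
    then have "apply_bcontfun (Bcontfun f) = f" by (rule Bcontfun_inverse)
    then show ?thesis using that by (auto simp: S_def)
  qed
  have "closed S"
    unfolding closed_sequential_limits
  proof (intro allI impI, elim conjE)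
    fix u :: "nat \<Rightarrow> real \<Rightarrow>\<^sub>C 'a" and l
    assume uS: "\<forall>n. u n \<in> S" and lim: "u \<longlonglongrightarrow> l"
    have pt: "(\<lambda>n. apply_bcontfun (u n) s) \<longlonglongrightarrow> apply_bcontfun l s" for s
      using tendsto_bcontfun_uniform_limit[OF lim] by (rule tendsto_uniform_limitI) simp
    have "apply_bcontfun l (s + 2 * pi) = apply_bcontfun l s" for s
    proof (rule LIMSEQ_unique[OF pt])
      have "apply_bcontfun (u n) (s + 2 * pi) = apply_bcontfun (u n) s" for n
        using uS by (auto simp: S_def dest: periodic_contD)
      then show "(\<lambda>n. apply_bcontfun (u n) (s + 2 * pi)) \<longlonglongrightarrow> apply_bcontfun l s"
        using pt by simp
    qed
    moreover have "norm (apply_bcontfun l s) \<le> \<rho>" for s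
      using tendsto_norm[OF pt[of s]] uS
      by (intro LIMSEQ_le_const2[where X = "\<lambda>n. norm (apply_bcontfun (u n) s)"]) (auto simp: S_def)
    ultimately show "l \<in> S" unfolding S_def by (auto intro: periodic_contI)
  qed
  then have "complete S" by (simp add: complete_eq_closed)
  moreover have "S \<noteq> {}"
    using inS[of "\<lambda>_. 0"] \<open>0 \<le> \<rho>\<close> by (auto simp: periodic_cont_def)
  moreover define F where "F u = Bcontfun (T (apply_bcontfun u))" for u
  have F: "F u \<in> S \<and> apply_bcontfun (F u) = T (apply_bcontfun u)" if "u \<in> S" for u
    using that inS[OF per bound, of "apply_bcontfun u"] unfolding F_def S_def by auto
  moreover have "dist (F u) (F v) \<le> 1 / 2 * dist u v" if "u \<in> S" "v \<in> S" for u v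
  proof (rule dist_bound)
    fix s
    have "norm (T (apply_bcontfun u) s - T (apply_bcontfun v) s) \<le> dist u v / 2"
      using that dist_bounded[of u _ v] by (intro contr) (auto simp: S_def dist_norm)
    then show "dist (apply_bcontfun (F u) s) (apply_bcontfun (F v) s) \<le> 1 / 2 * dist u v"
      using F that by (simp add: dist_norm)
  qed
  ultimately have "\<exists>!u\<in>S. F u = u"
    by (intro Banach_fix[where c = "1 / 2"]) auto
  then obtain u where "u \<in> S" "F u = u" by blast
  then show thesis
    using that[of "apply_bcontfun u"] F[of u] by (auto simp: S_def)
qed

section \<open>Convolution over one period\<close>

definition conv :: "(real \<Rightarrow> real) \<Rightarrow> (real \<Rightarrow> real) \<Rightarrow> real \<Rightarrow> real" where
  "conv k f s = integral {0..2 * pi} (\<lambda>\<sigma>. k \<sigma> * f (s - \<sigma>))"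

definition mean :: "(real \<Rightarrow> real) \<Rightarrow> real" where
  "mean f = integral {0..2 * pi} f / (2 * pi)"

lemma continuous_on_conv_integrand:
  fixes k f :: "real \<Rightarrow> real"
  assumes "continuous_on {0..2 * pi} k" "periodic_cont f"
  shows "continuous_on {0..2 * pi} (\<lambda>\<sigma>. k \<sigma> * f (s - \<sigma>))"
  by (intro continuous_intros assms(1) continuous_on_compose2[OF periodic_contD(1)[OF assms(2), of UNIV]]) auto

lemma conv_periodic:
  assumes "periodic_cont f"
  shows "conv k f (s + 2 * pi) = conv k f s"
proof -
  have "f (s + 2 * pi - \<sigma>) = f (s - \<sigma>)" for \<sigma>
    using periodic_contD(2)[OF assms, of "s - \<sigma>"] by (simp add: algebra_simps)
  then show ?thesis by (simp add: conv_def)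
qed

lemma abs_conv_le:
  assumes "continuous_on {0..2 * pi} k" "\<And>\<sigma>. \<sigma> \<in> {0..2 * pi} \<Longrightarrow> \<bar>k \<sigma>\<bar> \<le> A"
    and "periodic_cont f" "\<And>s. \<bar>f s\<bar> \<le> d"
  shows "\<bar>conv k f s\<bar> \<le> 2 * pi * A * d"
proof -
  have "0 \<le> A" using assms(2)[of 0] by auto
  have "norm (integral {0..2 * pi} (\<lambda>\<sigma>. k \<sigma> * f (s - \<sigma>))) \<le> (A * d) * (2 * pi - 0)"
    using assms \<open>0 \<le> A\<close>
    by (intro integral_bound continuous_on_conv_integrand) (auto simp: abs_mult intro!: mult_mono)
  then show ?thesis by (simp add: conv_def mult_ac)
qed

lemma conv_diff:
  assumes "continuous_on {0..2 * pi} k" "periodic_cont f" "periodic_cont g"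
  shows "conv k (\<lambda>s. f s - g s) s = conv k f s - conv k g s"
  unfolding conv_def
  using assms by (subst integral_diff[symmetric])
    (auto intro!: integrable_continuous_interval continuous_on_conv_integrand simp: right_diff_distrib)

lemma abs_mean_le:
  assumes "periodic_cont f" "\<And>s. \<bar>f s\<bar> \<le> d"
  shows "\<bar>mean f\<bar> \<le> d"
proof -
  have "norm (integral {0..2 * pi} f) \<le> d * (2 * pi - 0)"
    using assms by (intro integral_bound) (auto intro: periodic_contD)
  then show ?thesis by (simp add: mean_def field_simps abs_mult)
qed

lemma mean_diff:
  assumes "periodic_cont f" "periodic_cont g"
  shows "mean (\<lambda>s. f s - g s) = mean f - mean g"
  unfolding mean_def using assms
  by (subst integral_diff) (auto intro!: integrable_continuous_interval intro: periodic_contD simp: diff_divide_distrib)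

text \<open>The antiderivative must live on the whole line, because the arguments
  \<open>s - \<sigma>\<close> of a convolution range over all reals.\<close>

lemma periodic_cont_antiderivative:
  fixes f :: "real \<Rightarrow> real"
  assumes f: "periodic_cont f"
  obtains F where "\<And>x. (F has_real_derivative f x) (at x)"
proof -
  have "\<exists>F. \<forall>x::real. -\<infinity> < ereal x \<longrightarrow> ereal x < \<infinity> \<longrightarrow> (F has_vector_derivative f x) (at x)"
    using f by (intro einterval_antiderivative)
      (auto simp: continuous_on_eq_continuous_at periodic_cont_def)
  then show ?thesis
    using that by (auto simp: has_real_derivative_iff_has_vector_derivative)
qed

text \<open>All periods give the same integral, because \<open>F x - F (x - 2 * pi)\<close> has
  derivative \<open>f x - f (x - 2 * pi) = 0\<close> for an antiderivative \<open>F\<close> of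
  \<open>f\<close>.\<close>

lemma integral_reflect_period:
  assumes "periodic_cont f"
  shows "integral {0..2 * pi} (\<lambda>\<sigma>. f (s - \<sigma>)) = 2 * pi * mean f"
proof -
  obtain F where F: "(F has_real_derivative f x) (at x)" for x
    using periodic_cont_antiderivative[OF assms] by blast
  have "((\<lambda>x. F x - F (x - 2 * pi)) has_real_derivative 0) (at x)" for x
    by (auto intro!: derivative_eq_intros F DERIV_chain2[OF F] simp: periodic_cont_minus_period[OF assms])
  then have const: "F x - F (x - 2 * pi) = F y - F (y - 2 * pi)" for x y
    using DERIV_isconst_all[of "\<lambda>x. F x - F (x - 2 * pi)" x y] by blast
  have "((\<lambda>\<sigma>. f (s - \<sigma>)) has_integral (- F (s - 2 * pi) - (- F (s - 0)))) {0..2 * pi}"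
    by (intro fundamental_theorem_of_calculus)
      (auto simp flip: has_real_derivative_iff_has_vector_derivative
        intro!: derivative_eq_intros DERIV_chain2[OF F])
  moreover have "(f has_integral (F (2 * pi) - F 0)) {0..2 * pi}"
    by (intro fundamental_theorem_of_calculus)
      (auto simp flip: has_real_derivative_iff_has_vector_derivative
        intro!: DERIV_subset[OF F])
  ultimately show ?thesis
    using const[of s "2 * pi"] by (auto simp: mean_def dest!: integral_unique)
qed

text \<open>As \<open>f\<close> is only continuous, the integral cannot be differentiated directly.
  Integration by parts first replaces \<open>f\<close> by an antiderivative; differentiating under
  the integral sign is then legitimate, and the boundary terms produce \<open>f s\<close> times the
  jump \<open>k 0 - k (2 * pi)\<close>. A kernel with jump 1 therefore behaves like a Green's
  function.\<close>

lemma conv_has_derivative: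
  assumes k: "\<And>\<sigma>. \<sigma> \<in> {0..2 * pi} \<Longrightarrow> (k has_real_derivative k' \<sigma>) (at \<sigma>)"
    and k': "continuous_on {0..2 * pi} k'" and f: "periodic_cont f"
  shows "(conv k f has_real_derivative (k 0 - k (2 * pi)) * f s + conv k' f s) (at s)"
proof -
  obtain F where F: "(F has_real_derivative f x) (at x)" for x
    using periodic_cont_antiderivative[OF f] by blast
  have contF: "continuous_on S F" for S
    using F by (meson DERIV_continuous_on has_field_derivative_at_within)
  have kc: "continuous_on {0..2 * pi} k"
    using k by (meson DERIV_continuous_on has_field_derivative_at_within)
  have contkF: "continuous_on {0..2 * pi} (\<lambda>\<sigma>. k' \<sigma> * F (s - \<sigma>))" for s
    by (intro continuous_intros k' continuous_on_compose2[OF contF[of UNIV]]) auto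
  have eq: "conv k f s = k 0 * F s - k (2 * pi) * F (s - 2 * pi)
      + integral {0..2 * pi} (\<lambda>\<sigma>. k' \<sigma> * F (s - \<sigma>))" for s
  proof -
    have "((\<lambda>\<sigma>. k' \<sigma> * F (s - \<sigma>) + k \<sigma> * (- f (s - \<sigma>))) has_integral
        (k (2 * pi) * F (s - 2 * pi) - k 0 * F (s - 0))) {0..2 * pi}"
      by (intro fundamental_theorem_of_calculus)
        (auto simp flip: has_real_derivative_iff_has_vector_derivative
          intro!: derivative_eq_intros DERIV_subset[OF k] DERIV_chain2[OF F])
    from has_integral_diff[OF integrable_integral[OF integrable_continuous_interval[OF contkF[of s]]] this]
    show ?thesis by (auto simp: conv_def dest!: integral_unique)
  qed
  have "((\<lambda>s. integral (cbox 0 (2 * pi)) (\<lambda>\<sigma>. k' \<sigma> * F (s - \<sigma>))) has_real_derivative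
      integral (cbox 0 (2 * pi)) (\<lambda>\<sigma>. k' \<sigma> * f (s - \<sigma>))) (at s within UNIV)"
  proof (rule leibniz_rule_field_derivative)
    show "continuous_on (UNIV \<times> cbox 0 (2 * pi)) (\<lambda>(x, t). k' t * f (x - t))"
      unfolding split_beta
      by (intro continuous_intros continuous_on_compose2[OF k'] continuous_on_compose2[OF periodic_contD(1)[OF f, of UNIV]]) auto
  qed (auto intro!: derivative_eq_intros DERIV_chain2[OF F] integrable_continuous_interval contkF)
  then have D: "((\<lambda>s. integral {0..2 * pi} (\<lambda>\<sigma>. k' \<sigma> * F (s - \<sigma>))) has_real_derivative conv k' f s) (at s)"
    by (simp add: conv_def)
  show ?thesis
    unfolding eq
    by (auto intro!: derivative_eq_intros F D DERIV_chain2[OF F] simp: periodic_cont_minus_period[OF f] left_diff_distrib)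
qed

lemma periodic_cont_conv:
  assumes "\<And>\<sigma>. \<sigma> \<in> {0..2 * pi} \<Longrightarrow> (k has_real_derivative k' \<sigma>) (at \<sigma>)"
    and "continuous_on {0..2 * pi} k'" and "periodic_cont f"
  shows "periodic_cont (conv k f)"
  by (intro periodic_contI conv_periodic[OF assms(3)])
    (meson DERIV_continuous_on conv_has_derivative[OF assms] has_field_derivative_at_within)

section \<open>Harmonic oscillator kernels and the linearisation at a circular orbit\<close>

lemma periodic_cont_const [simp, intro]: "periodic_cont (\<lambda>_. c)"
  by (simp add: periodic_cont_def)

lemma periodic_cont_compose:
  assumes "periodic_cont f" "continuous_on UNIV h"
  shows "periodic_cont (\<lambda>s. h (f s))"
  using assms unfolding periodic_cont_def by (auto intro: continuous_on_compose2)

lemma periodic_cont_add [intro]: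
  fixes f g :: "real \<Rightarrow> 'a::real_normed_vector"
  shows "periodic_cont f \<Longrightarrow> periodic_cont g \<Longrightarrow> periodic_cont (\<lambda>s. f s + g s)"
  by (auto simp: periodic_cont_def intro!: continuous_intros)

lemma periodic_cont_diff [intro]:
  fixes f g :: "real \<Rightarrow> 'a::real_normed_vector"
  shows "periodic_cont f \<Longrightarrow> periodic_cont g \<Longrightarrow> periodic_cont (\<lambda>s. f s - g s)"
  by (auto simp: periodic_cont_def intro!: continuous_intros)

lemma periodic_cont_cmult [intro]:
  fixes f :: "real \<Rightarrow> real"
  shows "periodic_cont f \<Longrightarrow> periodic_cont (\<lambda>s. c * f s)"
  by (auto simp: periodic_cont_def intro!: continuous_intros)

lemma periodic_cont_divide [intro]:
  fixes f :: "real \<Rightarrow> real"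
  shows "periodic_cont f \<Longrightarrow> periodic_cont (\<lambda>s. f s / c)"
  using periodic_cont_cmult[of f "1 / c"] by simp

lemma mean_add:
  assumes "periodic_cont f" "periodic_cont g"
  shows "mean (\<lambda>s. f s + g s) = mean f + mean g"
  unfolding mean_def using assms
  by (subst integral_add) (auto intro!: integrable_continuous_interval intro: periodic_contD simp: add_divide_distrib)

lemma mean_cmult: "mean (\<lambda>s. c * f s) = c * mean f"
  by (simp add: mean_def)

lemma mean_divide: "mean (\<lambda>s. f s / c) = mean f / c"
  using mean_cmult[of "1 / c" f] by simp

lemma mean_const: "mean (\<lambda>_. c) = c"
  by (simp add: mean_def)

text \<open>With these properties, \<open>u = conv K f\<close> satisfies
  \<open>u'' + \<mu> u = f - mean f\<close>: the jump of \<open>K'\<close> reproduces the source,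
  and the constant \<open>- 1 / (2 * pi)\<close> removes its mean, which keeps \<mu> = 0 admissible.
  Other resonances are at squares of nonzero integers. In the application \<mu> = 3 - \<alpha> \<le>
  2, so that \<mu> = 1, that is \<alpha> = 2, is the only one to avoid.\<close>

lemma green_kernel:
  fixes \<mu> :: real
  assumes "\<mu> < 4" "\<mu> \<noteq> 1"
  obtains K K' where
    "\<And>\<sigma>. (K has_real_derivative K' \<sigma>) (at \<sigma>)"
    "\<And>\<sigma>. (K' has_real_derivative (- \<mu> * K \<sigma> - 1 / (2 * pi))) (at \<sigma>)"
    "K 0 = K (2 * pi)" "K' 0 - K' (2 * pi) = 1"
proof -
  consider "\<mu> > 0" | "\<mu> = 0" | "\<mu> < 0" by linarith
  then show thesis
  proof cases
    case 1
    define w where "w = sqrt \<mu>"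
    have w: "w > 0" "\<mu> = w\<^sup>2" using 1 by (simp_all add: w_def)
    have "w < 2" using assms(1) w by (metis abs_of_pos power2_less_imp_less zero_le_numeral four_x_squared mult_2 numeral_Bit0 power2_eq_square one_add_one)
    have "w \<noteq> 1" using assms(2) w by auto
    \<comment> \<open>The denominator of the kernel vanishes exactly at integer frequencies, and 1
      is the only integer strictly between 0 and 2.\<close>
    have sn: "sin (w * pi) \<noteq> 0"
    proof
      assume "sin (w * pi) = 0"
      then obtain i :: int where "w * pi = i * pi" by (auto simp: sin_zero_iff_int2)
      then have "w = i" by simp
      then have "0 < i" "i < 2" using \<open>w > 0\<close> \<open>w < 2\<close> by linarith+
      then show False using \<open>w = i\<close> \<open>w \<noteq> 1\<close> by simp
    qed
    show thesis
    \<comment> \<open>Symmetry about \<open>pi\<close> gives \<open>K 0 = K (2 * pi)\<close>. The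
      factor in front normalises the jump of \<open>K'\<close> to 1, and the subtracted constant
      accounts for \<open>- 1 / (2 * pi)\<close> in the equation for \<open>K'\<close>.\<close>
    proof (rule that[of "\<lambda>\<sigma>. cos (w * (\<sigma> - pi)) / (2 * w * sin (w * pi)) - 1 / (2 * pi * \<mu>)"
          "\<lambda>\<sigma>. - sin (w * (\<sigma> - pi)) / (2 * sin (w * pi))"])
    qed (use w sn in \<open>auto intro!: derivative_eq_intros simp: field_simps power2_eq_square\<close>)
  next
    case 2
    show thesis
      by (rule that[of "\<lambda>\<sigma>. - (\<sigma> - pi)\<^sup>2 / (4 * pi)" "\<lambda>\<sigma>. - (\<sigma> - pi) / (2 * pi)"])
        (use 2 in \<open>auto intro!: derivative_eq_intros simp: field_simps power2_eq_square\<close>)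
  next
    case 3
    define w where "w = sqrt (- \<mu>)"
    have w: "w > 0" "\<mu> = - w\<^sup>2" using 3 by (simp_all add: w_def)
    have sn: "sinh (w * pi) \<noteq> 0" using w by simp
    show thesis
    proof (rule that[of "\<lambda>\<sigma>. - cosh (w * (\<sigma> - pi)) / (2 * w * sinh (w * pi)) - 1 / (2 * pi * \<mu>)"
          "\<lambda>\<sigma>. - sinh (w * (\<sigma> - pi)) / (2 * sinh (w * pi))"])
    qed (use w sn in \<open>auto intro!: derivative_eq_intros simp: field_simps power2_eq_square\<close>)
  qed
qed

text \<open>The Green's function of \<open>d/ds\<close> on periodic functions of mean zero: constant
  slope and jump 1. Since it has mean zero itself, convolution with it picks the periodic
  antiderivative of mean zero.\<close>

definition saw :: "real \<Rightarrow> real" where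
  "saw \<sigma> = (pi - \<sigma>) / (2 * pi)"

lemma saw_has_derivative: "(saw has_real_derivative - 1 / (2 * pi)) (at \<sigma>)"
  unfolding saw_def[abs_def] by (auto intro!: derivative_eq_intros simp: field_simps)

lemma conv_saw_has_derivative:
  assumes "periodic_cont f"
  shows "(conv saw f has_real_derivative f s - mean f) (at s)"
proof -
  have "conv (\<lambda>_. - 1 / (2 * pi)) f s = - mean f"
    using integral_reflect_period[OF assms, of s] by (simp add: conv_def)
  then show ?thesis
    using conv_has_derivative[of saw "\<lambda>_. - 1 / (2 * pi)" f s] saw_has_derivative assms
    by (simp add: saw_def)
qed

lemma periodic_cont_conv_saw:
  "periodic_cont f \<Longrightarrow> periodic_cont (conv saw f)"
  by (rule periodic_cont_conv[OF saw_has_derivative]) auto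

lemma continuous_on_saw: "continuous_on S saw"
  unfolding saw_def[abs_def] by (intro continuous_intros) auto

lemma abs_conv_saw_le:
  assumes "periodic_cont f" "\<And>s. \<bar>f s\<bar> \<le> d"
  shows "\<bar>conv saw f s\<bar> \<le> pi * d"
  using abs_conv_le[of saw "1 / 2" f d s, OF continuous_on_saw _ assms] by (auto simp: saw_def field_simps abs_if)

text \<open>
  The three operators below solve \<open>\<nu>\<^sup>2 x'' - 2 \<nu> y' - (1 + \<alpha>) x = f1\<close>, \<open>\<nu>\<^sup>2 y'' + 2 \<nu> x' = f2\<close>.
  Integrating the second equation gives \<open>y'\<close> in terms of \<open>x\<close>, and substituting it into the first leaves
  \<open>\<nu>\<^sup>2 x'' + (3 - \<alpha>) x\<close> on the left. The slot \<open>e\<close> receives \<open>(3 - \<alpha>) (1 - 1 / \<nu>\<^sup>2) x\<close>, so that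
  the kernel \<open>K\<close> can be chosen independently of \<open>\<nu>\<close>.
\<close>

definition radial_source :: "real \<Rightarrow> (real \<Rightarrow> real) \<Rightarrow> (real \<Rightarrow> real) \<Rightarrow> (real \<Rightarrow> real) \<Rightarrow> real \<Rightarrow> real" where
  "radial_source \<nu> f1 f2 e = (\<lambda>s. (f1 s + 2 / \<nu> * conv saw f2 s) / \<nu>\<^sup>2 + e s)"

text \<open>The mean of \<open>x\<close> is prescribed separately. Averaging the first equation over
  a period leaves \<open>- (1 + \<alpha>) * mean x = mean f1\<close>, whereas \<open>K\<close>
  inverts the radial operator only modulo means and says nothing about the mean when \<alpha> =
  3.\<close>

definition radial_solution ::
  "(real \<Rightarrow> real) \<Rightarrow> real \<Rightarrow> real \<Rightarrow> (real \<Rightarrow> real) \<Rightarrow> (real \<Rightarrow> real) \<Rightarrow> (real \<Rightarrow> real) \<Rightarrow> real \<Rightarrow> real" where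
  "radial_solution K \<alpha> \<nu> f1 f2 e = (\<lambda>s. conv K (radial_source \<nu> f1 f2 e) s
     - mean (conv K (radial_source \<nu> f1 f2 e)) - mean f1 / (1 + \<alpha>))"

definition angular_solution :: "real \<Rightarrow> (real \<Rightarrow> real) \<Rightarrow> (real \<Rightarrow> real) \<Rightarrow> real \<Rightarrow> real" where
  "angular_solution \<nu> f2 x = (\<lambda>s. conv saw (\<lambda>s. conv saw f2 s - 2 * \<nu> * x s) s / \<nu>\<^sup>2)"

lemma periodic_cont_radial_source:
  assumes "periodic_cont f1" "periodic_cont f2" "periodic_cont e"
  shows "periodic_cont (radial_source \<nu> f1 f2 e)"
  unfolding radial_source_def using assms
  by (intro periodic_cont_add periodic_cont_divide periodic_cont_cmult periodic_cont_conv_saw)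

lemma periodic_cont_angular_solution:
  assumes "periodic_cont f2" "periodic_cont x"
  shows "periodic_cont (angular_solution \<nu> f2 x)"
  unfolding angular_solution_def using assms
  by (intro periodic_cont_diff periodic_cont_divide periodic_cont_cmult periodic_cont_conv_saw)

lemma angular_solution_diff:
  assumes "periodic_cont f2" "periodic_cont x" "periodic_cont g2" "periodic_cont x'"
  shows "angular_solution \<nu> f2 x s - angular_solution \<nu> g2 x' s
    = angular_solution \<nu> (\<lambda>s. f2 s - g2 s) (\<lambda>s. x s - x' s) s"
proof -
  have eq: "(\<lambda>s. conv saw (\<lambda>s. f2 s - g2 s) s - 2 * \<nu> * (x s - x' s))
     = (\<lambda>s. (conv saw f2 s - 2 * \<nu> * x s) - (conv saw g2 s - 2 * \<nu> * x' s))"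
    using assms by (auto simp: conv_diff continuous_on_saw algebra_simps)
  show ?thesis
    unfolding angular_solution_def eq using assms
    by (subst conv_diff) (auto intro!: continuous_on_saw periodic_cont_conv_saw simp: diff_divide_distrib)
qed

lemma radial_source_diff:
  assumes "periodic_cont f2" "periodic_cont g2"
  shows "(\<lambda>s. radial_source \<nu> f1 f2 e s - radial_source \<nu> g1 g2 e' s)
    = radial_source \<nu> (\<lambda>s. f1 s - g1 s) (\<lambda>s. f2 s - g2 s) (\<lambda>s. e s - e' s)"
  using assms by (auto simp: radial_source_def conv_diff continuous_on_saw diff_divide_distrib add_divide_distrib algebra_simps)

text \<open>Linearity turns Lipschitz estimates for the solver into size estimates for solutions
  with differenced data.\<close>

lemma radial_solution_diff:
  assumes K: "\<And>\<sigma>. (K has_real_derivative K' \<sigma>) (at \<sigma>)" "continuous_on {0..2 * pi} K'"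
    and "periodic_cont f1" "periodic_cont f2" "periodic_cont e"
    and "periodic_cont g1" "periodic_cont g2" "periodic_cont e'"
  shows "radial_solution K \<alpha> \<nu> f1 f2 e s - radial_solution K \<alpha> \<nu> g1 g2 e' s
    = radial_solution K \<alpha> \<nu> (\<lambda>s. f1 s - g1 s) (\<lambda>s. f2 s - g2 s) (\<lambda>s. e s - e' s) s"
proof -
  have Kc: "continuous_on {0..2 * pi} K"
    by (meson DERIV_continuous_on K(1) has_field_derivative_at_within)
  have "conv K (radial_source \<nu> (\<lambda>s. f1 s - g1 s) (\<lambda>s. f2 s - g2 s) (\<lambda>s. e s - e' s))
    = (\<lambda>s. conv K (radial_source \<nu> f1 f2 e) s - conv K (radial_source \<nu> g1 g2 e') s)"
    using assms by (auto simp flip: radial_source_diff intro!: conv_diff Kc periodic_cont_radial_source)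
  moreover have "periodic_cont (conv K (radial_source \<nu> f1 f2 e))" "periodic_cont (conv K (radial_source \<nu> g1 g2 e'))"
    using assms by (auto intro!: periodic_cont_conv[OF K] periodic_cont_radial_source)
  ultimately show ?thesis
    unfolding radial_solution_def using assms by (simp add: mean_diff diff_divide_distrib)
qed

text \<open>A single \<open>C\<close> serves all \<nu> in the range because \<open>K\<close> does
  not involve \<nu>: the parameter enters only through factors such as
  \<open>1 / \<nu> \<le> 2\<close> and \<open>1 / \<nu>\<^sup>2 \<le> 4\<close>.\<close>

lemma solutions_bound:
  assumes Kc: "\<And>\<sigma>. (K has_real_derivative K' \<sigma>) (at \<sigma>)" "continuous_on {0..2 * pi} K'" and "\<alpha> \<ge> 1"
  obtains C where "C > 0"
    "\<And>\<nu> f1 f2 e d s. 1 / 2 \<le> \<nu> \<Longrightarrow> \<nu> \<le> 1 \<Longrightarrow> periodic_cont f1 \<Longrightarrow> periodic_cont f2 \<Longrightarrow> periodic_cont e \<Longrightarrow>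
      (\<And>s. \<bar>f1 s\<bar> \<le> d) \<Longrightarrow> (\<And>s. \<bar>f2 s\<bar> \<le> d) \<Longrightarrow> (\<And>s. \<bar>e s\<bar> \<le> d) \<Longrightarrow>
      \<bar>radial_solution K \<alpha> \<nu> f1 f2 e s\<bar> \<le> C * d \<and>
      \<bar>angular_solution \<nu> f2 (radial_solution K \<alpha> \<nu> f1 f2 e) s\<bar> \<le> C * d"
proof -
  have contK: "continuous_on {0..2 * pi} K"
    by (meson DERIV_continuous_on Kc(1) has_field_derivative_at_within)
  then have "bounded (K ` {0..2 * pi})"
    by (intro compact_imp_bounded compact_continuous_image) auto
  then obtain A where A: "A > 0" "\<And>\<sigma>. \<sigma> \<in> {0..2 * pi} \<Longrightarrow> \<bar>K \<sigma>\<bar> \<le> A"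
    by (force simp: bounded_pos)
  \<comment> \<open>\<open>5 + 16 * pi\<close> is \<open>4 * (1 + 4 * pi) + 1\<close>: here 4 bounds
    \<open>1 / \<nu>\<^sup>2\<close>, \<open>4 * pi\<close> bounds \<open>2 / \<nu>\<close> times
    convolution with \<open>saw\<close>, and the final 1 is for \<open>e\<close>. \<open>C1\<close>
    adds up the convolution, its mean and \<open>mean f1 / (1 + \<alpha>)\<close>; \<open>C\<close>
    also covers the two convolutions with \<open>saw\<close> in the angular part.\<close>
  define U where "U = 2 * pi * A * (5 + 16 * pi)"
  define C1 where "C1 = 2 * U + 1"
  define C where "C = C1 + 4 * pi * (pi + 2 * C1)"
  have "U > 0" using A by (auto simp: U_def intro!: mult_pos_pos add_pos_pos)
  then have "C1 > 0" by (simp add: C1_def)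
  then have "C > 0" "C1 \<le> C" by (auto simp: C_def intro!: add_pos_pos mult_pos_pos)
  show thesis
  proof (rule that[OF \<open>C > 0\<close>])
    fix \<nu> d s :: real and f1 f2 e :: "real \<Rightarrow> real"
    assume \<nu>: "1 / 2 \<le> \<nu>" "\<nu> \<le> 1" and per: "periodic_cont f1" "periodic_cont f2" "periodic_cont e"
      and b: "\<And>s. \<bar>f1 s\<bar> \<le> d" "\<And>s. \<bar>f2 s\<bar> \<le> d" "\<And>s. \<bar>e s\<bar> \<le> d"
    have "d \<ge> 0" using b(1)[of 0] by linarith
    have iv: "1 / \<nu> \<le> 2" using \<nu> by (simp add: field_simps)
    have iv2: "\<bar>t / \<nu>\<^sup>2\<bar> \<le> 4 * \<bar>t\<bar>" for t
    proof -
      have "1 \<le> 4 * \<nu>\<^sup>2" using power_mono[OF \<nu>(1), of 2] by (simp add: power2_eq_square)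
      then have "\<bar>t\<bar> * 1 \<le> \<bar>t\<bar> * (4 * \<nu>\<^sup>2)" by (intro mult_left_mono) auto
      then show ?thesis using \<nu> by (simp add: field_simps)
    qed
    let ?H = "radial_source \<nu> f1 f2 e" and ?x = "radial_solution K \<alpha> \<nu> f1 f2 e"
    have H: "\<bar>?H s\<bar> \<le> (5 + 16 * pi) * d" for s
    proof -
      have "\<bar>2 / \<nu> * conv saw f2 s\<bar> \<le> 4 * (pi * d)"
        unfolding abs_mult using iv \<nu> abs_conv_saw_le[OF per(2) b(2)] by (intro mult_mono) auto
      then have "\<bar>f1 s + 2 / \<nu> * conv saw f2 s\<bar> \<le> d + 4 * (pi * d)"
        using b(1)[of s] by (intro order_trans[OF abs_triangle_ineq add_mono])
      then have "\<bar>(f1 s + 2 / \<nu> * conv saw f2 s) / \<nu>\<^sup>2\<bar> \<le> 4 * (d + 4 * (pi * d))"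
        by (intro order_trans[OF iv2]) simp
      from order_trans[OF abs_triangle_ineq add_mono[OF this b(3)[of s]]] show ?thesis
        unfolding radial_source_def by (simp add: algebra_simps)
    qed
    have perH: "periodic_cont ?H" using per by (rule periodic_cont_radial_source)
    have u: "\<bar>conv K ?H s\<bar> \<le> U * d" for s
      using abs_conv_le[OF contK A(2) perH H, of s] by (simp add: U_def mult_ac)
    have peru: "periodic_cont (conv K ?H)" by (rule periodic_cont_conv[OF Kc perH])
    have "\<bar>mean f1 / (1 + \<alpha>)\<bar> \<le> d"
    proof -
      have "\<bar>mean f1\<bar> \<le> d * 1" using abs_mean_le[OF per(1) b(1)] by simp
      also have "\<dots> \<le> d * (1 + \<alpha>)" using \<open>\<alpha> \<ge> 1\<close> \<open>d \<ge> 0\<close> by (intro mult_left_mono) auto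
      finally show ?thesis using \<open>\<alpha> \<ge> 1\<close> by (simp add: field_simps)
    qed
    then have x: "\<bar>?x s\<bar> \<le> C1 * d" for s
    proof -
      have "\<bar>a - b - c\<bar> \<le> C1 * d" if "\<bar>a\<bar> \<le> U * d" "\<bar>b\<bar> \<le> U * d" "\<bar>c\<bar> \<le> d" for a b c
        using that by (simp add: C1_def left_diff_distrib distrib_right)
      then show ?thesis
        using u[of s] abs_mean_le[OF peru u] \<open>\<bar>mean f1 / (1 + \<alpha>)\<bar> \<le> d\<close> unfolding radial_solution_def by blast
    qed
    have perx: "periodic_cont ?x"
      unfolding radial_solution_def using peru by (intro periodic_cont_diff) auto
    have "\<bar>conv saw f2 s - 2 * \<nu> * ?x s\<bar> \<le> (pi + 2 * C1) * d" for s
    proof -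
      have "\<bar>2 * \<nu> * ?x s\<bar> \<le> 2 * (C1 * d)"
        unfolding abs_mult using \<nu> x by (intro mult_mono) auto
      then show ?thesis
        using abs_conv_saw_le[OF per(2) b(2), of s] by (simp add: algebra_simps)
    qed
    then have "\<bar>conv saw (\<lambda>s. conv saw f2 s - 2 * \<nu> * ?x s) s\<bar> \<le> pi * ((pi + 2 * C1) * d)"
      using per perx by (intro abs_conv_saw_le periodic_cont_diff periodic_cont_cmult periodic_cont_conv_saw) auto
    then have "\<bar>angular_solution \<nu> f2 ?x s\<bar> \<le> 4 * (pi * ((pi + 2 * C1) * d))"
      using iv2 unfolding angular_solution_def by (smt (verit))
    also have "\<dots> \<le> C * d"
      using \<open>C1 > 0\<close> \<open>d \<ge> 0\<close> by (simp add: C_def algebra_simps)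
    finally show "\<bar>?x s\<bar> \<le> C * d \<and> \<bar>angular_solution \<nu> f2 ?x s\<bar> \<le> C * d"
      using x[of s] mult_right_mono[OF \<open>C1 \<le> C\<close> \<open>d \<ge> 0\<close>] by linarith
  qed
qed

text \<open>The mean of \<open>f2\<close> is the only obstruction to solving the system by periodic functions.\<close>

lemma solutions_ode:
  assumes K: "\<And>\<sigma>. (K has_real_derivative K' \<sigma>) (at \<sigma>)"
      "\<And>\<sigma>. (K' has_real_derivative (- (3 - \<alpha>) * K \<sigma> - 1 / (2 * pi))) (at \<sigma>)"
      "K 0 = K (2 * pi)" "K' 0 - K' (2 * pi) = 1"
    and "\<alpha> \<ge> 1" "0 < \<nu>" and per: "periodic_cont f1" "periodic_cont f2" "periodic_cont x"
    and x: "x = radial_solution K \<alpha> \<nu> f1 f2 (\<lambda>s. (3 - \<alpha>) * (1 - 1 / \<nu>\<^sup>2) * x s)"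
    and y: "y = angular_solution \<nu> f2 x"
  obtains x' x'' y' y'' where
    "\<And>s. (x has_real_derivative x' s) (at s)" "\<And>s. (x' has_real_derivative x'' s) (at s)"
    "\<And>s. (y has_real_derivative y' s) (at s)" "\<And>s. (y' has_real_derivative y'' s) (at s)"
    "\<And>s. \<nu>\<^sup>2 * x'' s - 2 * \<nu> * y' s - (1 + \<alpha>) * x s = f1 s"
    "\<And>s. \<nu>\<^sup>2 * y'' s + 2 * \<nu> * x' s = f2 s - mean f2"
proof -
  define \<mu> where "\<mu> = 3 - \<alpha>"
  define H where "H = radial_source \<nu> f1 f2 (\<lambda>s. \<mu> * (1 - 1 / \<nu>\<^sup>2) * x s)"
  define u where "u = conv K H"
  define m where "m = mean f1 / (1 + \<alpha>)"
  define G where "G = (\<lambda>s. conv saw f2 s - 2 * \<nu> * x s)"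
  have K'c: "continuous_on {0..2 * pi} K'"
    by (meson DERIV_continuous_on K(2) has_field_derivative_at_within)
  have Kc: "continuous_on {0..2 * pi} K"
    by (meson DERIV_continuous_on K(1) has_field_derivative_at_within)
  have perH: "periodic_cont H"
    unfolding H_def using per by (intro periodic_cont_radial_source periodic_cont_cmult)
  have peru: "periodic_cont u"
    unfolding u_def by (rule periodic_cont_conv[OF K(1) K'c perH])
  have perG: "periodic_cont G"
    unfolding G_def using per by (intro periodic_cont_diff periodic_cont_cmult periodic_cont_conv_saw)
  have x_eq: "x = (\<lambda>s. u s - mean u - m)"
    by (subst x) (simp add: radial_solution_def u_def m_def H_def \<mu>_def)
  have du: "(u has_real_derivative conv K' H s) (at s)" for s
    unfolding u_def using conv_has_derivative[OF K(1) K'c perH, of s] K(3) by simp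
  have conv_eq: "conv (\<lambda>\<sigma>. - \<mu> * K \<sigma> - 1 / (2 * pi)) H s = - \<mu> * u s - mean H" for s
  proof -
    have "((\<lambda>\<sigma>. K \<sigma> * H (s - \<sigma>)) has_integral u s) {0..2 * pi}"
      unfolding u_def conv_def
      by (intro integrable_integral integrable_continuous_interval continuous_on_conv_integrand Kc perH)
    moreover have "((\<lambda>\<sigma>. H (s - \<sigma>)) has_integral 2 * pi * mean H) {0..2 * pi}"
      unfolding integral_reflect_period[OF perH, of s, symmetric]
      by (intro integrable_integral integrable_continuous_interval
          continuous_on_compose2[OF periodic_contD(1)[OF perH, of UNIV]] continuous_intros) auto
    ultimately have "((\<lambda>\<sigma>. - \<mu> * (K \<sigma> * H (s - \<sigma>)) - 1 / (2 * pi) * H (s - \<sigma>)) has_integral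
       (- \<mu> * u s - 1 / (2 * pi) * (2 * pi * mean H))) {0..2 * pi}"
      by (intro has_integral_diff has_integral_mult_right)
    then show ?thesis by (auto simp: conv_def algebra_simps dest!: integral_unique)
  qed
  have ddu: "(conv K' H has_real_derivative H s - \<mu> * u s - mean H) (at s)" for s
  proof -
    have "continuous_on {0..2 * pi} (\<lambda>\<sigma>. - \<mu> * K \<sigma> - 1 / (2 * pi))"
      by (intro continuous_intros Kc)
    from conv_has_derivative[OF K(2)[folded \<mu>_def] this perH, of s] conv_eq K(4) show ?thesis
      by (simp add: add_diff_eq)
  qed
  \<comment> \<open>This is the average of \<open>u'' + \<mu> u = H - mean H\<close>. For \<mu>
    \<noteq> 0 it determines \<open>mean u\<close>, for \<mu> = 0 it leaves it free; the final
    computation involves only the product, so both cases are treated at once.\<close>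
  have "\<mu> * mean u = 0"
  proof -
    have "((\<lambda>s. H s - \<mu> * u s - mean H) has_integral (conv K' H (2 * pi) - conv K' H 0)) {0..2 * pi}"
      by (intro fundamental_theorem_of_calculus)
        (auto simp flip: has_real_derivative_iff_has_vector_derivative intro!: DERIV_subset[OF ddu])
    moreover have "conv K' H (2 * pi) = conv K' H 0"
      using conv_periodic[OF perH, of K' 0] by simp
    ultimately have "mean (\<lambda>s. H s - \<mu> * u s - mean H) = 0"
      by (auto simp: mean_def dest!: integral_unique)
    moreover have "mean (\<lambda>s. H s - \<mu> * u s - mean H) = mean H - \<mu> * mean u - mean H"
      using perH peru by (simp add: mean_diff mean_cmult mean_const periodic_cont_diff periodic_cont_cmult)
    ultimately show ?thesis by simp
  qed
  have mx: "mean x = - m"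
    unfolding x_eq using peru by (simp add: mean_diff mean_const periodic_cont_diff)
  have mG: "mean G = mean (conv saw f2) + 2 * \<nu> * m"
    unfolding G_def using per mx mean_cmult[of "2 * \<nu>" x]
    by (subst mean_diff) (auto intro: periodic_cont_conv_saw)
  have mH: "mean H = (mean f1 + 2 / \<nu> * mean (conv saw f2)) / \<nu>\<^sup>2 - \<mu> * (1 - 1 / \<nu>\<^sup>2) * m"
  proof -
    have "mean H = (mean f1 + mean (\<lambda>s. 2 / \<nu> * conv saw f2 s)) / \<nu>\<^sup>2 + mean (\<lambda>s. \<mu> * (1 - 1 / \<nu>\<^sup>2) * x s)"
      unfolding H_def radial_source_def using per
      by (simp only: mean_add mean_divide periodic_cont_add periodic_cont_divide periodic_cont_cmult periodic_cont_conv_saw)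
    then show ?thesis
      using mx by (simp only: mean_cmult)
  qed
  have dG: "(G has_real_derivative (f2 s - mean f2 - 2 * \<nu> * conv K' H s)) (at s)" for s
    unfolding G_def x_eq
    by (auto intro!: derivative_eq_intros conv_saw_has_derivative[OF per(2)] du)
  show thesis
  proof (rule that[of "conv K' H" "\<lambda>s. H s - \<mu> * u s - mean H" "\<lambda>s. (G s - mean G) / \<nu>\<^sup>2"
        "\<lambda>s. (f2 s - mean f2 - 2 * \<nu> * conv K' H s) / \<nu>\<^sup>2"])
    fix s
    show "(x has_real_derivative conv K' H s) (at s)"
      unfolding x_eq by (auto intro!: derivative_eq_intros du)
    show "(conv K' H has_real_derivative H s - \<mu> * u s - mean H) (at s)" by (rule ddu)
    show "(y has_real_derivative (G s - mean G) / \<nu>\<^sup>2) (at s)"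
      unfolding y angular_solution_def G_def[symmetric]
      by (intro DERIV_cdivide conv_saw_has_derivative perG)
    show "((\<lambda>s. (G s - mean G) / \<nu>\<^sup>2) has_real_derivative (f2 s - mean f2 - 2 * \<nu> * conv K' H s) / \<nu>\<^sup>2) (at s)"
      by (rule DERIV_cdivide) (auto intro!: derivative_eq_intros dG)
    show "\<nu>\<^sup>2 * ((f2 s - mean f2 - 2 * \<nu> * conv K' H s) / \<nu>\<^sup>2) + 2 * \<nu> * conv K' H s = f2 s - mean f2"
      using \<open>0 < \<nu>\<close> by (simp add: field_simps)
    have nH: "\<nu>\<^sup>2 * H s = f1 s + 2 / \<nu> * conv saw f2 s + \<mu> * (\<nu>\<^sup>2 - 1) * x s"
      using \<open>0 < \<nu>\<close> by (simp add: H_def radial_source_def field_simps)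
    have nmH: "\<nu>\<^sup>2 * mean H = mean f1 + 2 / \<nu> * mean (conv saw f2) - \<mu> * (\<nu>\<^sup>2 - 1) * m"
      using \<open>0 < \<nu>\<close> by (simp add: mH field_simps)
    have nG: "2 * \<nu> * ((G s - mean G) / \<nu>\<^sup>2)
        = 2 / \<nu> * conv saw f2 s - 4 * x s - 2 / \<nu> * mean (conv saw f2) - 4 * m"
      unfolding mG using \<open>0 < \<nu>\<close> by (simp add: G_def field_simps power2_eq_square)
    have mf1: "mean f1 = (4 - \<mu>) * m" using \<open>\<alpha> \<ge> 1\<close> by (simp add: m_def \<mu>_def)
    have "\<nu>\<^sup>2 * (H s - \<mu> * u s - mean H) - 2 * \<nu> * ((G s - mean G) / \<nu>\<^sup>2) - (1 + \<alpha>) * x s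
       = \<nu>\<^sup>2 * H s - \<nu>\<^sup>2 * \<mu> * u s - \<nu>\<^sup>2 * mean H - 2 * \<nu> * ((G s - mean G) / \<nu>\<^sup>2) - (4 - \<mu>) * x s"
      by (simp add: algebra_simps \<mu>_def)
    also have "\<dots> = f1 s + (\<mu> * (\<nu>\<^sup>2 - 1) * x s - \<nu>\<^sup>2 * \<mu> * u s - (4 - \<mu>) * m
        + \<mu> * (\<nu>\<^sup>2 - 1) * m + 4 * x s + 4 * m - (4 - \<mu>) * x s)"
      unfolding nH nmH nG mf1 by simp
    \<comment> \<open>Inserting \<open>x s = u s - mean u - m\<close> cancels everything except a
      multiple of \<open>\<mu> * mean u\<close>.\<close>
    also have "\<mu> * (\<nu>\<^sup>2 - 1) * x s - \<nu>\<^sup>2 * \<mu> * u s - (4 - \<mu>) * m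
        + \<mu> * (\<nu>\<^sup>2 - 1) * m + 4 * x s + 4 * m - (4 - \<mu>) * x s = - \<nu>\<^sup>2 * (\<mu> * mean u)"
      by (simp add: x_eq algebra_simps)
    finally show "\<nu>\<^sup>2 * (H s - \<mu> * u s - mean H) - 2 * \<nu> * ((G s - mean G) / \<nu>\<^sup>2) - (1 + \<alpha>) * x s = f1 s"
      using \<open>\<mu> * mean u = 0\<close> by simp
  qed
qed

lemma conv_zero: "conv k (\<lambda>_. 0) = (\<lambda>_. 0)"
  by (simp add: conv_def fun_eq_iff)

text \<open>\<open>S\<close> inverts the linearised operator only when its last argument is the
  \<nu>-correction of its own output. Hence the last clause speaks of fixed points, and the
  contraction for the nonlinear problem closes this loop together with the nonlinearity. The
  residual \<open>c\<close> is the mean of \<open>Im f\<close>, the part of the force that no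
  periodic function can balance.\<close>

lemma linearized_solver:
  fixes \<alpha> :: real
  assumes "\<alpha> \<ge> 1" "\<alpha> \<noteq> 2"
  obtains C :: real and S :: "real \<Rightarrow> (real \<Rightarrow> complex) \<Rightarrow> (real \<Rightarrow> real) \<Rightarrow> real \<Rightarrow> complex" where
    "C > 0"
    "\<And>\<nu> f e. periodic_cont f \<Longrightarrow> periodic_cont e \<Longrightarrow> periodic_cont (S \<nu> f e)"
    "\<And>\<nu> s. S \<nu> (\<lambda>_. 0) (\<lambda>_. 0) s = 0"
    "\<And>\<nu> f g e e' d s. 1 / 2 \<le> \<nu> \<Longrightarrow> \<nu> \<le> 1 \<Longrightarrow> periodic_cont f \<Longrightarrow> periodic_cont e \<Longrightarrow>
       periodic_cont g \<Longrightarrow> periodic_cont e' \<Longrightarrow> (\<And>s. norm (f s - g s) \<le> d) \<Longrightarrow> (\<And>s. \<bar>e s - e' s\<bar> \<le> d) \<Longrightarrow>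
       norm (S \<nu> f e s - S \<nu> g e' s) \<le> C * d"
    "\<And>\<nu> f \<zeta>. 0 < \<nu> \<Longrightarrow> periodic_cont f \<Longrightarrow> periodic_cont \<zeta> \<Longrightarrow>
       \<zeta> = S \<nu> f (\<lambda>s. (3 - \<alpha>) * (1 - 1 / \<nu>\<^sup>2) * Re (\<zeta> s)) \<Longrightarrow>
       \<exists>c \<zeta>' \<zeta>''. (\<forall>s. (\<zeta> has_vector_derivative \<zeta>' s) (at s)) \<and> (\<forall>s. (\<zeta>' has_vector_derivative \<zeta>'' s) (at s)) \<and>
         (\<forall>s. complex_of_real (\<nu>\<^sup>2) * \<zeta>'' s + 2 * \<i> * complex_of_real \<nu> * \<zeta>' s = complex_of_real ((1 + \<alpha>) * Re (\<zeta> s)) + f s - \<i> * complex_of_real c)"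
proof -
  obtain K K' where K: "\<And>\<sigma>. (K has_real_derivative K' \<sigma>) (at \<sigma>)"
      "\<And>\<sigma>. (K' has_real_derivative (- (3 - \<alpha>) * K \<sigma> - 1 / (2 * pi))) (at \<sigma>)"
      "K 0 = K (2 * pi)" "K' 0 - K' (2 * pi) = 1"
    using green_kernel[of "3 - \<alpha>"] assms by auto
  have K'c: "continuous_on {0..2 * pi} K'"
    by (meson DERIV_continuous_on K(2) has_field_derivative_at_within)
  obtain C where C: "C > 0" and bound:
    "\<And>\<nu> f1 f2 e d s. 1 / 2 \<le> \<nu> \<Longrightarrow> \<nu> \<le> 1 \<Longrightarrow> periodic_cont f1 \<Longrightarrow> periodic_cont f2 \<Longrightarrow> periodic_cont e \<Longrightarrow>
      (\<And>s. \<bar>f1 s\<bar> \<le> d) \<Longrightarrow> (\<And>s. \<bar>f2 s\<bar> \<le> d) \<Longrightarrow> (\<And>s. \<bar>e s\<bar> \<le> d) \<Longrightarrow>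
      \<bar>radial_solution K \<alpha> \<nu> f1 f2 e s\<bar> \<le> C * d \<and>
      \<bar>angular_solution \<nu> f2 (radial_solution K \<alpha> \<nu> f1 f2 e) s\<bar> \<le> C * d"
    using solutions_bound[OF K(1) K'c \<open>\<alpha> \<ge> 1\<close>] by blast
  define X where "X \<nu> f e = radial_solution K \<alpha> \<nu> (\<lambda>s. Re (f s)) (\<lambda>s. Im (f s)) e" for \<nu> f e
  define Y where "Y \<nu> f e = angular_solution \<nu> (\<lambda>s. Im (f s)) (X \<nu> f e)" for \<nu> f e
  define S where "S \<nu> f e s = Complex (X \<nu> f e s) (Y \<nu> f e s)" for \<nu> f e s
  have perRI: "periodic_cont (\<lambda>s. Re (f s))" "periodic_cont (\<lambda>s. Im (f s))" if "periodic_cont f" for f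
    by (rule periodic_cont_compose[OF that, of Re], intro continuous_intros)
      (rule periodic_cont_compose[OF that, of Im], intro continuous_intros)
  have perX: "periodic_cont (X \<nu> f e)" if "periodic_cont f" "periodic_cont e" for \<nu> f e
    using that perRI[OF that(1)] unfolding X_def radial_solution_def
    by (intro periodic_cont_diff periodic_cont_const periodic_cont_conv[OF K(1) K'c] periodic_cont_radial_source) auto
  have perY: "periodic_cont (Y \<nu> f e)" if "periodic_cont f" "periodic_cont e" for \<nu> f e
    using that perRI[OF that(1)] perX[OF that] unfolding Y_def by (intro periodic_cont_angular_solution)
  show thesis
  proof (rule that[of "2 * C" S])
    show "2 * C > 0" using C by simp
    show "periodic_cont (S \<nu> f e)" if "periodic_cont f" "periodic_cont e" for \<nu> f e
      using perX[OF that, of \<nu>] perY[OF that, of \<nu>] unfolding S_def[abs_def] periodic_cont_def Complex_eq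
      by (auto intro!: continuous_intros)
    show "S \<nu> (\<lambda>_. 0) (\<lambda>_. 0) s = 0" for \<nu> s
      by (simp add: S_def X_def Y_def radial_solution_def radial_source_def angular_solution_def conv_zero mean_const complex_eq_iff)
  next
    fix \<nu> d s :: real and f g :: "real \<Rightarrow> complex" and e e' :: "real \<Rightarrow> real"
    assume \<nu>: "1 / 2 \<le> \<nu>" "\<nu> \<le> 1" and per: "periodic_cont f" "periodic_cont e" "periodic_cont g" "periodic_cont e'"
      and d: "\<And>s. norm (f s - g s) \<le> d" "\<And>s. \<bar>e s - e' s\<bar> \<le> d"
    let ?f1 = "\<lambda>s. Re (f s) - Re (g s)" and ?f2 = "\<lambda>s. Im (f s) - Im (g s)" and ?e = "\<lambda>s. e s - e' s"
    note p = perRI[OF per(1)] perRI[OF per(3)] per(2,4)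
    have dX: "X \<nu> f e s - X \<nu> g e' s = radial_solution K \<alpha> \<nu> ?f1 ?f2 ?e s" for s
      unfolding X_def by (rule radial_solution_diff[OF K(1) K'c]) (fact p)+
    have dY: "Y \<nu> f e s - Y \<nu> g e' s = angular_solution \<nu> ?f2 (radial_solution K \<alpha> \<nu> ?f1 ?f2 ?e) s"
      unfolding Y_def using p per perX
      by (subst angular_solution_diff) (auto simp: dX)
    have "\<bar>?f1 s\<bar> \<le> d" "\<bar>?f2 s\<bar> \<le> d" for s
      using d(1)[of s] abs_Re_le_cmod[of "f s - g s"] abs_Im_le_cmod[of "f s - g s"] by auto
    then have "\<bar>X \<nu> f e s - X \<nu> g e' s\<bar> \<le> C * d \<and> \<bar>Y \<nu> f e s - Y \<nu> g e' s\<bar> \<le> C * d"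
      unfolding dX dY using \<nu> p d(2) by (intro bound periodic_cont_diff)
    then show "norm (S \<nu> f e s - S \<nu> g e' s) \<le> 2 * C * d"
      using cmod_le[of "S \<nu> f e s - S \<nu> g e' s"] by (simp add: S_def)
  next
    fix \<nu> :: real and f \<zeta> :: "real \<Rightarrow> complex"
    assume \<nu>: "0 < \<nu>" and per: "periodic_cont f" "periodic_cont \<zeta>"
      and \<zeta>: "\<zeta> = S \<nu> f (\<lambda>s. (3 - \<alpha>) * (1 - 1 / \<nu>\<^sup>2) * Re (\<zeta> s))"
    define x where "x = (\<lambda>s. Re (\<zeta> s))"
    define y where "y = (\<lambda>s. Im (\<zeta> s))"
    have x: "x = radial_solution K \<alpha> \<nu> (\<lambda>s. Re (f s)) (\<lambda>s. Im (f s)) (\<lambda>s. (3 - \<alpha>) * (1 - 1 / \<nu>\<^sup>2) * x s)"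
      unfolding x_def by (subst \<zeta>) (simp add: S_def X_def)
    have "y = Y \<nu> f (\<lambda>s. (3 - \<alpha>) * (1 - 1 / \<nu>\<^sup>2) * x s)"
      unfolding y_def by (subst \<zeta>) (simp add: S_def x_def)
    then have y: "y = angular_solution \<nu> (\<lambda>s. Im (f s)) x"
      by (simp only: Y_def X_def x[symmetric])
    obtain x' x'' y' y'' where xy:
      "\<And>s. (x has_real_derivative x' s) (at s)" "\<And>s. (x' has_real_derivative x'' s) (at s)"
      "\<And>s. (y has_real_derivative y' s) (at s)" "\<And>s. (y' has_real_derivative y'' s) (at s)"
      "\<And>s. \<nu>\<^sup>2 * x'' s - 2 * \<nu> * y' s - (1 + \<alpha>) * x s = Re (f s)"
      "\<And>s. \<nu>\<^sup>2 * y'' s + 2 * \<nu> * x' s = Im (f s) - mean (\<lambda>s. Im (f s))"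
      using solutions_ode[OF K \<open>\<alpha> \<ge> 1\<close> \<nu> perRI[OF per(1)] perRI(1)[OF per(2), folded x_def] x y] by blast
    show "\<exists>c \<zeta>' \<zeta>''. (\<forall>s. (\<zeta> has_vector_derivative \<zeta>' s) (at s)) \<and> (\<forall>s. (\<zeta>' has_vector_derivative \<zeta>'' s) (at s)) \<and>
         (\<forall>s. complex_of_real (\<nu>\<^sup>2) * \<zeta>'' s + 2 * \<i> * complex_of_real \<nu> * \<zeta>' s = complex_of_real ((1 + \<alpha>) * Re (\<zeta> s)) + f s - \<i> * complex_of_real c)"
    proof (intro exI conjI allI)
      fix s
      show "(\<zeta> has_vector_derivative Complex (x' s) (y' s)) (at s)"
        using xy(1,3) by (simp add: has_vector_derivative_complex_iff x_def y_def has_real_derivative_iff_has_vector_derivative)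
      show "((\<lambda>s. Complex (x' s) (y' s)) has_vector_derivative Complex (x'' s) (y'' s)) (at s)"
        using xy(2,4) by (simp add: has_vector_derivative_complex_iff has_real_derivative_iff_has_vector_derivative)
      show "complex_of_real (\<nu>\<^sup>2) * Complex (x'' s) (y'' s) + 2 * \<i> * complex_of_real \<nu> * Complex (x' s) (y' s)
         = complex_of_real ((1 + \<alpha>) * Re (\<zeta> s)) + f s - \<i> * complex_of_real (mean (\<lambda>s. Im (f s)))"
        using xy(5,6)[of s] by (simp add: complex_eq_iff x_def)
    qed
  qed
qed

section \<open>The attraction of a fixed centre\<close>

definition grav :: "real \<Rightarrow> 'a::real_inner \<Rightarrow> 'a" where
  "grav \<alpha> x = (1 / norm x powr (\<alpha> + 1)) *\<^sub>R x"

definition grav_deriv :: "real \<Rightarrow> 'a::real_inner \<Rightarrow> 'a \<Rightarrow> 'a" where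
  "grav_deriv \<alpha> x h = (norm x powr (- (\<alpha> + 1))) *\<^sub>R h - ((\<alpha> + 1) * norm x powr (- (\<alpha> + 3)) * (x \<bullet> h)) *\<^sub>R x"

lemma grav_scaleR:
  assumes "c > 0"
  shows "grav \<alpha> (c *\<^sub>R x) = (c powr (- \<alpha>)) *\<^sub>R grav \<alpha> x"
  using assms by (simp add: grav_def powr_mult powr_minus powr_add field_simps)

lemma norm_powr_has_derivative:
  fixes x :: "'a::real_inner"
  assumes "x \<noteq> 0"
  shows "((\<lambda>x. norm x powr r) has_derivative (\<lambda>h. r * norm x powr (r - 2) * (x \<bullet> h))) (at x)"
proof -
  have "((\<lambda>t. t powr r) has_real_derivative r * norm x powr (r - 1)) (at (norm x))"
    using assms by (auto intro!: derivative_eq_intros)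
  from DERIV_compose_FDERIV[OF this has_derivative_norm[OF assms]]
  have "((\<lambda>x. norm x powr r) has_derivative (\<lambda>h. (h \<bullet> sgn x) * (r * norm x powr (r - 1)))) (at x)" .
  moreover have "norm x powr (r - 1) = norm x powr (r - 2) * norm x"
    using powr_mult_base[of "norm x" "r - 2"] by (simp add: mult.commute)
  then have "(h \<bullet> sgn x) * (r * norm x powr (r - 1)) = r * norm x powr (r - 2) * (x \<bullet> h)" for h
    using assms by (simp add: sgn_div_norm inner_commute field_simps)
  ultimately show ?thesis by simp
qed

lemma grav_has_derivative:
  fixes x :: "'a::real_inner"
  assumes "x \<noteq> 0"
  shows "(grav \<alpha> has_derivative grav_deriv \<alpha> x) (at x)"
proof -
  have "((\<lambda>x. (norm x powr (- (\<alpha> + 1))) *\<^sub>R x) has_derivative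
     (\<lambda>h. (norm x powr (- (\<alpha> + 1))) *\<^sub>R h + (- (\<alpha> + 1) * norm x powr (- (\<alpha> + 1) - 2) * (x \<bullet> h)) *\<^sub>R x)) (at x)"
    by (intro has_derivative_scaleR norm_powr_has_derivative assms has_derivative_ident)
  moreover have "(grav \<alpha> :: 'a \<Rightarrow> 'a) = (\<lambda>x. (norm x powr (- (\<alpha> + 1))) *\<^sub>R x)"
    unfolding grav_def[abs_def] powr_minus_divide by simp
  moreover have "- (\<alpha> + 1) - 2 = - (\<alpha> + 3)" by simp
  then have "grav_deriv \<alpha> x = (\<lambda>h. (norm x powr (- (\<alpha> + 1))) *\<^sub>R h
      + (- (\<alpha> + 1) * norm x powr (- (\<alpha> + 1) - 2) * (x \<bullet> h)) *\<^sub>R x)"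
    by (simp only: grav_deriv_def[abs_def] mult_minus_left scaleR_minus_left diff_conv_add_uminus[symmetric])
  ultimately show ?thesis by (simp only:)
qed

lemma bounded_linear_grav_deriv: "bounded_linear (grav_deriv \<alpha> x)"
  unfolding grav_deriv_def[abs_def]
  by (intro bounded_linear_sub bounded_linear_scaleR_right bounded_linear_scaleR_const
      bounded_linear_const_mult bounded_linear_inner_right)

text \<open>Strict differentiability: the derivative is continuous at \<open>b\<close>, so by the
  mean value inequality the nonlinear remainder has an arbitrarily small Lipschitz constant near
  \<open>b\<close>. Used at \<open>b = 1\<close> to obtain a contraction and, with \<eta> = 1, to
  bound the force of a distant primary.\<close>

lemma grav_strict_derivative:
  fixes b :: "'a::real_inner"
  assumes "b \<noteq> 0" "\<eta> > 0"
  obtains \<delta> where "\<delta> > 0"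
    "\<And>x y. x \<in> ball b \<delta> \<Longrightarrow> y \<in> ball b \<delta> \<Longrightarrow>
      norm (grav \<alpha> x - grav \<alpha> y - grav_deriv \<alpha> b (x - y)) \<le> \<eta> * norm (x - y)"
    "0 \<notin> ball b \<delta>"
proof -
  define c where "c x = norm x powr (- (\<alpha> + 3))" for x :: 'a
  \<comment> \<open>A bound for the operator norm of
    \<open>grav_deriv \<alpha> x - grav_deriv \<alpha> b\<close>. The three products arise from
    \<open>(c x * (x \<bullet> h)) *\<^sub>R x\<close> by changing one occurrence of
    \<open>x\<close> to \<open>b\<close> at a time.\<close>
  define \<phi> where "\<phi> x = \<bar>norm x powr (- (\<alpha> + 1)) - norm b powr (- (\<alpha> + 1))\<bar>
    + \<bar>\<alpha> + 1\<bar> * (\<bar>c x\<bar> * norm x * norm (x - b) + \<bar>c x - c b\<bar> * norm x * norm b + \<bar>c b\<bar> * norm (x - b) * norm b)" for x :: 'a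
  have "isCont \<phi> b"
    unfolding \<phi>_def c_def using \<open>b \<noteq> 0\<close> by (intro continuous_intros) auto
  moreover have "\<phi> b = 0" by (simp add: \<phi>_def)
  ultimately have "(\<phi> \<longlongrightarrow> 0) (nhds b)"
    unfolding isCont_def by (metis tendsto_at_iff_tendsto_nhds)
  then have "\<forall>\<^sub>F x in nhds b. \<phi> x < \<eta>"
    using \<open>\<eta> > 0\<close> by (rule order_tendstoD)
  then obtain \<delta>0 where \<delta>0: "\<delta>0 > 0" "\<And>x. dist x b < \<delta>0 \<Longrightarrow> \<phi> x < \<eta>"
    by (auto simp: eventually_nhds_metric)
  define \<delta> where "\<delta> = min \<delta>0 (norm b)"
  have nz: "0 \<notin> ball b \<delta>" by (auto simp: \<delta>_def)
  have diff: "norm (grav_deriv \<alpha> x h - grav_deriv \<alpha> b h) \<le> \<phi> x * norm h" for x h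
  proof -
    have eq: "grav_deriv \<alpha> x h - grav_deriv \<alpha> b h
      = (norm x powr (- (\<alpha> + 1)) - norm b powr (- (\<alpha> + 1))) *\<^sub>R h
        - (\<alpha> + 1) *\<^sub>R ((c x * (x \<bullet> h)) *\<^sub>R (x - b) + ((c x - c b) * (x \<bullet> h)) *\<^sub>R b + (c b * ((x - b) \<bullet> h)) *\<^sub>R b)"
      by (simp add: grav_deriv_def c_def algebra_simps inner_diff_left)
    define v where "v = (c x * (x \<bullet> h)) *\<^sub>R (x - b) + ((c x - c b) * (x \<bullet> h)) *\<^sub>R b + (c b * ((x - b) \<bullet> h)) *\<^sub>R b"
    have "norm v \<le> \<bar>c x\<bar> * (norm x * norm h) * norm (x - b) + \<bar>c x - c b\<bar> * (norm x * norm h) * norm b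
        + \<bar>c b\<bar> * (norm (x - b) * norm h) * norm b"
      unfolding v_def by (intro norm_triangle_le add_mono) (auto simp: abs_mult intro!: mult_mono Cauchy_Schwarz_ineq2)
    from mult_left_mono[OF this, of "\<bar>\<alpha> + 1\<bar>"]
    have "norm ((\<alpha> + 1) *\<^sub>R v) \<le> \<phi> x * norm h - \<bar>norm x powr (- (\<alpha> + 1)) - norm b powr (- (\<alpha> + 1))\<bar> * norm h"
      unfolding norm_scaleR by (simp add: \<phi>_def algebra_simps)
    then show ?thesis
      unfolding eq v_def[symmetric] by (intro order_trans[OF norm_triangle_ineq4]) simp
  qed
  show thesis
  proof (rule that[of \<delta>])
    show "\<delta> > 0" using \<open>b \<noteq> 0\<close> \<delta>0 by (simp add: \<delta>_def)
    show "0 \<notin> ball b \<delta>" by (rule nz)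
    fix x y assume xy: "x \<in> ball b \<delta>" "y \<in> ball b \<delta>"
    have "norm ((grav \<alpha> x - grav_deriv \<alpha> b x) - (grav \<alpha> y - grav_deriv \<alpha> b y)) \<le> \<eta> * norm (x - y)"
    proof (rule differentiable_bound[where S = "ball b \<delta>" and f' = "\<lambda>x h. grav_deriv \<alpha> x h - grav_deriv \<alpha> b h"])
      fix z assume z: "z \<in> ball b \<delta>"
      then have "z \<noteq> 0" using nz by auto
      then show "((\<lambda>x. grav \<alpha> x - grav_deriv \<alpha> b x) has_derivative (\<lambda>h. grav_deriv \<alpha> z h - grav_deriv \<alpha> b h)) (at z within ball b \<delta>)"
        by (intro has_derivative_diff has_derivative_at_withinI[OF grav_has_derivative]
            bounded_linear_imp_has_derivative bounded_linear_grav_deriv)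
      have "\<phi> z \<le> \<eta>" using z \<delta>0(2)[of z] by (simp add: \<delta>_def dist_commute)
      then show "onorm (\<lambda>h. grav_deriv \<alpha> z h - grav_deriv \<alpha> b h) \<le> \<eta>"
        using \<open>\<eta> > 0\<close> by (intro onorm_bound order_trans[OF diff mult_right_mono]) auto
    qed (use xy in auto)
    then show "norm (grav \<alpha> x - grav \<alpha> y - grav_deriv \<alpha> b (x - y)) \<le> \<eta> * norm (x - y)"
      by (simp add: linear_diff[OF bounded_linear.linear[OF bounded_linear_grav_deriv]] algebra_simps)
  qed
qed

text \<open>The primitive of \<open>r powr (- \<alpha>)\<close> is a power except at \<alpha> = 1,
  where the logarithm takes over.\<close>

lemma grav_potential:
  fixes \<alpha> :: real
  obtains U :: "'a::real_inner \<Rightarrow> real" where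
    "\<And>x. x \<noteq> 0 \<Longrightarrow> (U has_derivative (\<lambda>h. grav \<alpha> x \<bullet> h)) (at x)"
proof (cases "\<alpha> = 1")
  case False
  show thesis
  proof (rule that[of "\<lambda>x. norm x powr (1 - \<alpha>) / (1 - \<alpha>)"])
    fix x :: 'a assume "x \<noteq> 0"
    have "((\<lambda>x. norm x powr (1 - \<alpha>) / (1 - \<alpha>)) has_derivative
        (\<lambda>h. ((1 - \<alpha>) * norm x powr (1 - \<alpha> - 2) * (x \<bullet> h)) / (1 - \<alpha>))) (at x)"
      by (intro bounded_linear.has_derivative[OF bounded_linear_divide] norm_powr_has_derivative \<open>x \<noteq> 0\<close>)
    moreover have "1 - \<alpha> - 2 = - (\<alpha> + 1)" by simp
    then have "norm x powr (1 - \<alpha> - 2) = 1 / norm x powr (\<alpha> + 1)" by (simp only: powr_minus_divide)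
    ultimately show "((\<lambda>x. norm x powr (1 - \<alpha>) / (1 - \<alpha>)) has_derivative (\<lambda>h. grav \<alpha> x \<bullet> h)) (at x)"
      using False by (simp add: grav_def)
  qed
next
  case True
  show thesis
  proof (rule that[of "\<lambda>x. ln (norm x)"])
    fix x :: 'a assume "x \<noteq> 0"
    have "((\<lambda>x. ln (norm x)) has_derivative (\<lambda>h. (h \<bullet> sgn x) * (1 / norm x))) (at x)"
      using \<open>x \<noteq> 0\<close> by (intro DERIV_compose_FDERIV[where f = ln] has_derivative_norm) (auto intro!: derivative_eq_intros)
    then show "((\<lambda>x. ln (norm x)) has_derivative (\<lambda>h. grav \<alpha> x \<bullet> h)) (at x)"
      using \<open>x \<noteq> 0\<close> True by (simp add: grav_def sgn_div_norm inner_commute field_simps power2_eq_square powr_numeral)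
  qed
qed

section \<open>Periodic orbits near the circular one\<close>

lemma gradient_chain:
  fixes W :: "real \<Rightarrow> 'a::real_inner"
  assumes "(\<Psi> has_derivative (\<lambda>h. g \<bullet> h)) (at (W s))" "(W has_vector_derivative w) (at s)"
  shows "((\<lambda>s. \<Psi> (W s)) has_real_derivative g \<bullet> w) (at s)"
  using has_derivative_compose[OF assms(2)[unfolded has_vector_derivative_def] assms(1)]
  by (simp add: has_field_derivative_def mult_commute_abs)

lemma inner_cis_mult: "a \<bullet> (cis s * b) = (cis (- s) * a) \<bullet> b"
  by (simp add: inner_complex_def algebra_simps)

lemma grav_cis_mult: "grav \<alpha> (cis s * z) = cis s * grav \<alpha> z"
  by (simp add: grav_def norm_mult)

text \<open>The sum of the Jacobi integral and \<open>c * Im z\<close> is periodic, and its derivative is \<open>- c * Re z\<close>.\<close>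

lemma no_residual_force:
  fixes z z' z'' :: "real \<Rightarrow> complex" and p :: "complex \<Rightarrow> complex" and c \<nu> \<alpha> :: real
  assumes z: "\<And>s. (z has_vector_derivative z' s) (at s)" "\<And>s. (z' has_vector_derivative z'' s) (at s)"
    and per: "\<And>s. z (s + 2 * pi) = z s"
    and pos: "\<And>s. Re (z s) > 0" and bd: "\<And>s. norm (z s) < 2"
    and pot: "\<And>w. norm w < 2 \<Longrightarrow> (V has_derivative (\<lambda>h. p w \<bullet> h)) (at w)"
    and ode: "\<And>s. complex_of_real (\<nu>\<^sup>2) * z'' s + 2 * \<i> * complex_of_real \<nu> * z' s
       = z s - grav \<alpha> (z s) + cis (- s) * p (cis s * z s) - \<i> * complex_of_real c"
  shows "c = 0"
proof -
  obtain U where U: "\<And>x::complex. x \<noteq> 0 \<Longrightarrow> (U has_derivative (\<lambda>h. grav \<alpha> x \<bullet> h)) (at x)"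
    using grav_potential by blast
  \<comment> \<open>In the application \<kappa> = 1 / \<omega> is the angular speed of the primaries
    relative to that of the satellite. \<open>W\<close> is the scaled position in the rotating frame
    and \<open>cis s * v s\<close> its derivative. \<open>E\<close> is the kinetic energy less the
    centrifugal potential, plus the potential of the attraction and minus that of
    \<open>p\<close>.\<close>
  define \<kappa> where "\<kappa> = 1 - \<nu>"
  define v where "v s = \<i> * z s + z' s" for s
  define W where "W s = cis s * z s" for s
  define E where "E s = \<nu>\<^sup>2 / 2 * (v s \<bullet> v s) - \<kappa>\<^sup>2 / 2 * (W s \<bullet> W s) + U (W s) - V (W s)" for s
  have z'per: "z' (s + 2 * pi) = z' s" for s
  proof -
    have "((\<lambda>s. s + 2 * pi) has_vector_derivative 1) (at s)"
      by (auto simp flip: has_real_derivative_iff_has_vector_derivative intro!: derivative_eq_intros)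
    from vector_diff_chain_at[OF this z(1)]
    have "((\<lambda>s. z (s + 2 * pi)) has_vector_derivative z' (s + 2 * pi)) (at s)"
      by (simp add: o_def)
    then show ?thesis using z(1)[of s] per by (simp add: vector_derivative_unique_at)
  qed
  have dv: "(v has_vector_derivative \<i> * z' s + z'' s) (at s)" for s
    unfolding v_def by (auto intro!: derivative_eq_intros z)
  have dcis: "(cis has_vector_derivative \<i> * cis s) (at s)" for s
    unfolding has_vector_derivative_complex_iff
    by (auto simp flip: has_real_derivative_iff_has_vector_derivative intro!: derivative_eq_intros)
  have dW: "(W has_vector_derivative cis s * v s) (at s)" for s
    unfolding W_def v_def by (auto intro!: derivative_eq_intros z dcis simp: algebra_simps)
  have Wz: "W s \<noteq> 0" "norm (W s) < 2" for s
    using pos[of s] bd[of s] by (auto simp: W_def norm_mult)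
  have sq: "((\<lambda>s. x s \<bullet> x s) has_real_derivative 2 * (x s \<bullet> x')) (at s)"
    if "(x has_vector_derivative x') (at s)" for x :: "real \<Rightarrow> complex" and x' s
  proof -
    have "((\<lambda>x. x \<bullet> x) has_derivative (\<lambda>h. (2 *\<^sub>R x s) \<bullet> h)) (at (x s))"
      by (auto intro!: derivative_eq_intros simp: inner_commute)
    from gradient_chain[OF this that] show ?thesis by simp
  qed
  have dE: "((\<lambda>s. E s + c * Im (z s)) has_real_derivative - c * Re (z s)) (at s)" for s
  proof -
    have dIm: "((\<lambda>s. Im (z s)) has_real_derivative Im (z' s)) (at s)"
      using z(1)[of s] by (simp add: has_vector_derivative_complex_iff)
    have "((\<lambda>s. E s + c * Im (z s)) has_real_derivative
        \<nu>\<^sup>2 / 2 * (2 * (v s \<bullet> (\<i> * z' s + z'' s))) - \<kappa>\<^sup>2 / 2 * (2 * (W s \<bullet> (cis s * v s)))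
        + grav \<alpha> (W s) \<bullet> (cis s * v s) - p (W s) \<bullet> (cis s * v s) + c * Im (z' s)) (at s)"
      unfolding E_def
      by (intro DERIV_add DERIV_diff DERIV_cmult sq dv dW dIm
          gradient_chain[OF U[OF Wz(1)] dW] gradient_chain[OF pot[OF Wz(2)] dW])
    moreover define X where "X = \<nu>\<^sup>2 *\<^sub>R (\<i> * z' s + z'' s) - \<kappa>\<^sup>2 *\<^sub>R z s + grav \<alpha> (z s) - cis (- s) * p (W s)"
    have Xv: "\<nu>\<^sup>2 / 2 * (2 * (v s \<bullet> (\<i> * z' s + z'' s))) - \<kappa>\<^sup>2 / 2 * (2 * (W s \<bullet> (cis s * v s)))
        + grav \<alpha> (W s) \<bullet> (cis s * v s) - p (W s) \<bullet> (cis s * v s) = X \<bullet> v s"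
      unfolding inner_cis_mult W_def[of s] grav_cis_mult
      by (simp add: X_def W_def inner_diff_left inner_add_left inner_commute[of "v s"] mult.assoc[symmetric] cis_mult)
    \<comment> \<open>The terms proportional to the velocity combine into a real multiple of
      \<open>\<i> * v s\<close>. Like a Coriolis force this is orthogonal to \<open>v s\<close> and
      does no work, so the power is due to the residual \<open>c\<close> alone.\<close>
    have X: "X = complex_of_real (- (1 - \<kappa>\<^sup>2)) * (\<i> * v s) - \<i> * complex_of_real c"
    proof -
      have "X = (complex_of_real (\<nu>\<^sup>2) * z'' s + 2 * \<i> * complex_of_real \<nu> * z' s)
          + (complex_of_real (\<nu>\<^sup>2) - 2 * complex_of_real \<nu>) * (\<i> * z' s)
          - complex_of_real (\<kappa>\<^sup>2) * z s + grav \<alpha> (z s) - cis (- s) * p (W s)"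
        unfolding X_def scaleR_conv_of_real by (simp add: algebra_simps)
      also have "\<dots> = complex_of_real (- (1 - \<kappa>\<^sup>2)) * (\<i> * v s) - \<i> * complex_of_real c"
        unfolding ode v_def \<kappa>_def W_def by (simp add: algebra_simps power2_eq_square)
      finally show ?thesis .
    qed
    have "X \<bullet> v s = - c * Im (v s)"
      unfolding X by (simp add: inner_complex_def algebra_simps)
    then have "X \<bullet> v s + c * Im (z' s) = - c * Re (z s)"
      by (simp add: v_def algebra_simps)
    ultimately show ?thesis unfolding Xv by simp
  qed
  have "E (2 * pi) + c * Im (z (2 * pi)) = E 0 + c * Im (z 0)"
    using per[of 0] z'per[of 0] by (simp add: E_def v_def W_def)
  \<comment> \<open>The values at both ends of the period agree, so the derivative
    \<open>- c * Re (z \<xi>)\<close> vanishes at some \<xi>; positivity of \<open>Re z\<close> then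
    gives \<open>c = 0\<close>.\<close>
  moreover obtain \<xi> where "E (2 * pi) + c * Im (z (2 * pi)) - (E 0 + c * Im (z 0)) = (2 * pi - 0) * (- c * Re (z \<xi>))"
    using MVT2[of 0 "2 * pi" "\<lambda>s. E s + c * Im (z s)" "\<lambda>s. - c * Re (z s)"] dE by auto
  ultimately show ?thesis using pos[of \<xi>] by simp
qed

text \<open>A contraction in a ball of radius proportional to \<Lambda> around \<open>z = 1\<close>.
  The centre is an exact solution for \<open>p = 0\<close> whatever \<nu> is, so the distance is
  bounded by \<Lambda> with no term in \<open>1 - \<nu>\<close>. The potential \<open>V\<close>
  feeds the energy balance that removes the residual.\<close>

lemma periodic_satellite_orbit:
  fixes \<alpha> :: real
  assumes "\<alpha> \<ge> 1" "\<alpha> \<noteq> 2"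
  obtains C \<Lambda>0 \<nu>0 :: real where "C > 0" "\<Lambda>0 > 0" "\<nu>0 < 1"
    "\<And>\<Lambda> \<nu> p V. \<Lambda> \<le> \<Lambda>0 \<Longrightarrow> \<nu>0 \<le> \<nu> \<Longrightarrow> \<nu> \<le> 1 \<Longrightarrow> p 0 = 0 \<Longrightarrow> \<Lambda>-lipschitz_on (ball 0 2) p \<Longrightarrow>
      (\<And>w. norm w < 2 \<Longrightarrow> (V has_derivative (\<lambda>h. p w \<bullet> h)) (at w)) \<Longrightarrow>
      \<exists>z z' z''. (\<forall>s. (z has_vector_derivative z' s) (at s)) \<and> (\<forall>s. (z' has_vector_derivative z'' s) (at s)) \<and>
        (\<forall>s. z (s + 2 * pi) = z s) \<and> (\<forall>s. norm (z s - 1) \<le> C * \<Lambda>) \<and> (\<forall>s. norm (z s - 1) \<le> 1 / 2) \<and>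
        (\<forall>s. complex_of_real (\<nu>\<^sup>2) * z'' s + 2 * \<i> * complex_of_real \<nu> * z' s
          = z s - grav \<alpha> (z s) + cis (- s) * p (cis s * z s))"
proof -
  obtain C S where C: "C > 0"
    and Sper: "\<And>\<nu> f e. periodic_cont f \<Longrightarrow> periodic_cont e \<Longrightarrow> periodic_cont (S \<nu> f e)"
    and S0: "\<And>\<nu> s. S \<nu> (\<lambda>_. 0) (\<lambda>_. 0) s = (0::complex)"
    and Sdiff: "\<And>\<nu> f g e e' d s. 1 / 2 \<le> \<nu> \<Longrightarrow> \<nu> \<le> 1 \<Longrightarrow> periodic_cont f \<Longrightarrow> periodic_cont e \<Longrightarrow>
       periodic_cont g \<Longrightarrow> periodic_cont e' \<Longrightarrow> (\<And>s. norm (f s - g s) \<le> d) \<Longrightarrow> (\<And>s. \<bar>e s - e' s\<bar> \<le> d) \<Longrightarrow>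
       norm (S \<nu> f e s - S \<nu> g e' s) \<le> C * d"
    and Sode: "\<And>\<nu> f \<zeta>. 0 < \<nu> \<Longrightarrow> periodic_cont f \<Longrightarrow> periodic_cont \<zeta> \<Longrightarrow>
       \<zeta> = S \<nu> f (\<lambda>s. (3 - \<alpha>) * (1 - 1 / \<nu>\<^sup>2) * Re (\<zeta> s)) \<Longrightarrow>
       \<exists>c \<zeta>' \<zeta>''. (\<forall>s. (\<zeta> has_vector_derivative \<zeta>' s) (at s)) \<and> (\<forall>s. (\<zeta>' has_vector_derivative \<zeta>'' s) (at s)) \<and>
         (\<forall>s. complex_of_real (\<nu>\<^sup>2) * \<zeta>'' s + 2 * \<i> * complex_of_real \<nu> * \<zeta>' s = complex_of_real ((1 + \<alpha>) * Re (\<zeta> s)) + f s - \<i> * complex_of_real c)"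
  proof (rule linearized_solver[OF assms], goal_cases)
    case (1 C S)
    show thesis by (rule 1(1)) (fact 1(2-6))+
  qed
  \<comment> \<open>The perturbation and the nonlinear remainder each get Lipschitz constant \<eta>,
    and the \<nu>-correction gets \<open>2 * \<eta>\<close>. As the solver has Lipschitz constant
    \<open>C\<close>, the fixed point map contracts by
    \<open>2 * C * \<eta> = 1 / 4\<close>.\<close>
  define \<eta> where "\<eta> = 1 / (8 * C)"
  have \<eta>: "\<eta> > 0" using C by (simp add: \<eta>_def)
  obtain \<delta> where \<delta>: "\<delta> > 0" and strict: "\<And>x y. x \<in> ball 1 \<delta> \<Longrightarrow> y \<in> ball 1 \<delta> \<Longrightarrow>
      norm (grav \<alpha> x - grav \<alpha> y - grav_deriv \<alpha> (1::complex) (x - y)) \<le> \<eta> * norm (x - y)"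
    by (rule grav_strict_derivative[of "1::complex" \<eta> \<alpha>]) (simp, rule \<eta>, blast)
  define \<rho>0 where "\<rho>0 = min (1 / 2) (\<delta> / 2)"
  \<comment> \<open>The second entry keeps the radius \<open>2 * C * \<Lambda>\<close> of the ball
    below \<open>\<rho>0\<close>, where the remainder estimate holds.\<close>
  define \<Lambda>0 where "\<Lambda>0 = min \<eta> (\<rho>0 / (2 * C))"
  \<comment> \<open>The nonlinear part of \<open>z - grav \<alpha> z\<close> at
    \<open>z = 1 + w\<close>; the linear part \<open>(1 + \<alpha>) * Re w\<close> is built into the
    solver.\<close>
  define Q where "Q w = (1 + w) - grav \<alpha> (1 + w) - complex_of_real ((1 + \<alpha>) * Re w)" for w
  have \<rho>0: "\<rho>0 > 0" "\<rho>0 \<le> 1 / 2" "\<rho>0 < \<delta>" using \<delta> by (auto simp: \<rho>0_def)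
  have \<Lambda>0: "\<Lambda>0 > 0" using \<rho>0 \<eta> C by (simp add: \<Lambda>0_def)
  have Q0: "Q 0 = 0" by (simp add: Q_def grav_def)
  have Qdiff: "norm (Q x - Q y) \<le> \<eta> * norm (x - y)" if "norm x \<le> \<rho>0" "norm y \<le> \<rho>0" for x y
  proof -
    have "Q x - Q y = - (grav \<alpha> (1 + x) - grav \<alpha> (1 + y) - grav_deriv \<alpha> 1 ((1 + x) - (1 + y)))"
      by (simp add: Q_def grav_deriv_def inner_complex_def scaleR_conv_of_real algebra_simps)
    also have "norm \<dots> \<le> \<eta> * norm ((1 + x) - (1 + y))"
      unfolding norm_minus_cancel using that \<rho>0 by (intro strict) (auto simp: dist_norm)
    finally show ?thesis by simp
  qed
  define k where "k \<nu> = \<bar>(3 - \<alpha>) * (1 - 1 / \<nu>\<^sup>2)\<bar>" for \<nu> :: real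
  have "isCont k 1"
    unfolding k_def by (intro continuous_intros) auto
  moreover have "k 1 = 0" by (simp add: k_def)
  ultimately have "(k \<longlongrightarrow> 0) (nhds 1)"
    unfolding isCont_def by (metis tendsto_at_iff_tendsto_nhds)
  then have "\<forall>\<^sub>F \<nu> in nhds 1. k \<nu> < 2 * \<eta>"
    using \<eta> by (intro order_tendstoD) auto
  then obtain \<delta>' where \<delta>': "\<delta>' > 0" "\<And>\<nu>::real. dist \<nu> 1 < \<delta>' \<Longrightarrow> \<bar>(3 - \<alpha>) * (1 - 1 / \<nu>\<^sup>2)\<bar> < 2 * \<eta>"
    by (auto simp: eventually_nhds_metric k_def)
  define \<nu>0 where "\<nu>0 = max (1 / 2) (1 - \<delta>' / 2)"
  have "\<nu>0 < 1" using \<delta>' by (simp add: \<nu>0_def)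
  show thesis
  proof (rule that[of "2 * C" \<Lambda>0 \<nu>0])
    show "2 * C > 0" "\<Lambda>0 > 0" "\<nu>0 < 1" using C \<Lambda>0 \<open>\<nu>0 < 1\<close> by auto
    fix \<Lambda> \<nu> :: real and p :: "complex \<Rightarrow> complex" and V :: "complex \<Rightarrow> real"
    assume \<Lambda>: "\<Lambda> \<le> \<Lambda>0" and \<nu>: "\<nu>0 \<le> \<nu>" "\<nu> \<le> 1" and p0: "p 0 = 0" and lip: "\<Lambda>-lipschitz_on (ball 0 2) p"
      and pot: "\<And>w. norm w < 2 \<Longrightarrow> (V has_derivative (\<lambda>h. p w \<bullet> h)) (at w)"
    have \<nu>2: "1 / 2 \<le> \<nu>" "0 < \<nu>" using \<nu> by (auto simp: \<nu>0_def)
    have \<nu>small: "\<bar>(3 - \<alpha>) * (1 - 1 / \<nu>\<^sup>2)\<bar> \<le> 2 * \<eta>"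
      using \<delta>'(1) \<nu> by (intro less_imp_le \<delta>'(2)) (auto simp: \<nu>0_def dist_real_def)
    have "\<Lambda> \<ge> 0" using lip by (rule lipschitz_on_nonneg)
    define \<rho> where "\<rho> = 2 * C * \<Lambda>"
    have \<rho>: "0 \<le> \<rho>" "\<rho> \<le> \<rho>0" using \<Lambda> C \<open>\<Lambda> \<ge> 0\<close> by (auto simp: \<rho>_def \<Lambda>0_def field_simps)
    have "\<Lambda> \<le> \<eta>" using \<Lambda> by (simp add: \<Lambda>0_def)
    define F where "F \<zeta> s = cis (- s) * p (cis s * (1 + \<zeta> s)) + Q (\<zeta> s)" for \<zeta> s
    define e where "e \<zeta> s = (3 - \<alpha>) * (1 - 1 / \<nu>\<^sup>2) * Re (\<zeta> s)" for \<zeta> :: "real \<Rightarrow> complex" and s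
    define T where "T \<zeta> = S \<nu> (F \<zeta>) (e \<zeta>)" for \<zeta>
    have nb: "norm (1 + w) < 2" "1 + w \<noteq> 0" if "norm w \<le> \<rho>" for w :: complex
    proof -
      have "norm w \<le> 1 / 2" using that \<rho> \<rho>0 by linarith
      then show "norm (1 + w) < 2" using norm_triangle_ineq[of 1 w] by simp
      show "1 + w \<noteq> 0"
      proof
        assume "1 + w = 0"
        then have "w = - 1" by (simp add: eq_neg_iff_add_eq_0 add.commute)
        then show False using \<open>norm w \<le> 1 / 2\<close> by simp
      qed
    qed
    have perF: "periodic_cont (F \<zeta>)" if "periodic_cont \<zeta>" "\<And>s. norm (\<zeta> s) \<le> \<rho>" for \<zeta>
    proof (rule periodic_contI)
      note \<zeta>c = periodic_contD(1)[OF that(1)]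
      have cp: "continuous_on (ball 0 2) p" using lip by (rule lipschitz_on_continuous_on)
      have cg: "continuous_on (UNIV - {0}) (grav \<alpha> :: complex \<Rightarrow> complex)"
        using has_derivative_continuous[OF grav_has_derivative]
        by (auto intro!: continuous_at_imp_continuous_on)
      show "continuous_on UNIV (F \<zeta>)"
        unfolding F_def Q_def
        by (intro continuous_intros \<zeta>c continuous_on_compose2[OF cp] continuous_on_compose2[OF cg])
          (use nb that(2) in \<open>auto simp: norm_mult\<close>)
      show "F \<zeta> (s + 2 * pi) = F \<zeta> s" for s
      proof -
        have "cis (s + 2 * pi) = cis s" "cis (- (s + 2 * pi)) = cis (- s)"
          by (simp_all add: complex_eq_iff cos_diff sin_diff)
        then show ?thesis
          using periodic_contD(2)[OF that(1), of s] by (simp only: F_def)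
      qed
    qed
    have pere: "periodic_cont (e \<zeta>)" if "periodic_cont \<zeta>" for \<zeta>
      unfolding e_def[abs_def]
      by (rule periodic_cont_cmult, rule periodic_cont_compose[OF that, of Re]) (intro continuous_intros)
    have pdiff: "norm (p (cis s * (1 + x)) - p (cis s * (1 + y))) \<le> \<Lambda> * norm (x - y)"
      if "norm x \<le> \<rho>" "norm y \<le> \<rho>" for x y s
    proof -
      have "dist (p (cis s * (1 + x))) (p (cis s * (1 + y))) \<le> \<Lambda> * dist (cis s * (1 + x)) (cis s * (1 + y))"
        using that nb by (intro lipschitz_onD[OF lip]) (auto simp: norm_mult)
      moreover have "dist (cis s * (1 + x)) (cis s * (1 + y)) = norm (x - y)"
        by (simp add: dist_norm norm_mult flip: right_diff_distrib)
      ultimately show ?thesis by (simp add: dist_norm)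
    qed
    have Fdiff: "norm (F f s - F g s) \<le> 2 * \<eta> * norm (f s - g s)"
      if "\<And>s. norm (f s) \<le> \<rho>" "\<And>s. norm (g s) \<le> \<rho>" for f g s
    proof -
      have "F f s - F g s = cis (- s) * (p (cis s * (1 + f s)) - p (cis s * (1 + g s))) + (Q (f s) - Q (g s))"
        by (simp add: F_def algebra_simps)
      also have "norm \<dots> \<le> \<Lambda> * norm (f s - g s) + \<eta> * norm (f s - g s)"
      proof (rule norm_triangle_mono)
        show "norm (cis (- s) * (p (cis s * (1 + f s)) - p (cis s * (1 + g s)))) \<le> \<Lambda> * norm (f s - g s)"
          using pdiff[OF that(1)[of s] that(2)[of s]] by (simp add: norm_mult)
        show "norm (Q (f s) - Q (g s)) \<le> \<eta> * norm (f s - g s)"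
          using that \<rho> by (intro Qdiff) (auto intro: order_trans)
      qed
      also have "\<Lambda> * norm (f s - g s) \<le> \<eta> * norm (f s - g s)"
        using \<open>\<Lambda> \<le> \<eta>\<close> by (intro mult_right_mono) auto
      finally show ?thesis by simp
    qed
    have contr: "norm (T f s - T g s) \<le> d / 2"
      if "periodic_cont f" "\<And>s. norm (f s) \<le> \<rho>" "periodic_cont g" "\<And>s. norm (g s) \<le> \<rho>"
        "\<And>s. norm (f s - g s) \<le> d" for f g d s
    proof -
      have "d \<ge> 0" using that(5)[of 0] norm_ge_zero order_trans by blast
      have "norm (T f s - T g s) \<le> C * (2 * \<eta> * d)"
        unfolding T_def
      proof (rule Sdiff[OF \<nu>2(1) \<nu>(2)])
        show "periodic_cont (F f)" "periodic_cont (F g)" "periodic_cont (e f)" "periodic_cont (e g)"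
          using that by (auto intro: perF pere)
        fix s
        show "norm (F f s - F g s) \<le> 2 * \<eta> * d"
          using \<eta> by (intro order_trans[OF Fdiff mult_left_mono[OF that(5)]] that(2,4)) simp
        have "\<bar>e f s - e g s\<bar> = \<bar>(3 - \<alpha>) * (1 - 1 / \<nu>\<^sup>2)\<bar> * \<bar>Re (f s - g s)\<bar>"
          by (simp add: e_def abs_mult[symmetric] right_diff_distrib)
        also have "\<dots> \<le> 2 * \<eta> * d"
          using \<nu>small order_trans[OF abs_Re_le_cmod that(5)[of s]] \<eta> by (intro mult_mono) auto
        finally show "\<bar>e f s - e g s\<bar> \<le> 2 * \<eta> * d" .
      qed
      also have "C * (2 * \<eta> * d) = d / 4" using C by (simp add: \<eta>_def)
      finally show ?thesis using \<open>d \<ge> 0\<close> by simp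
    qed
    \<comment> \<open>The image of the centre is at distance at most
      \<open>C * \<Lambda> = \<rho> / 2\<close>. With contraction factor \<open>1 / 2\<close>, this
      makes the ball of radius \<rho> invariant.\<close>
    have T0: "norm (T (\<lambda>_. 0) s) \<le> C * \<Lambda>" for s
    proof -
      have "norm (S \<nu> (F (\<lambda>_. 0)) (e (\<lambda>_. 0)) s - S \<nu> (\<lambda>_. 0) (\<lambda>_. 0) s) \<le> C * \<Lambda>"
      proof (rule Sdiff[OF \<nu>2(1) \<nu>(2)])
        fix s
        have "dist (p (cis s)) (p 0) \<le> \<Lambda> * dist (cis s) 0"
          by (intro lipschitz_onD[OF lip]) auto
        then show "norm (F (\<lambda>_. 0) s - 0) \<le> \<Lambda>"
          using p0 by (simp add: F_def Q0 norm_mult)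
      qed (use perF[of "\<lambda>_. 0"] pere[of "\<lambda>_. 0"] \<rho>(1) \<open>\<Lambda> \<ge> 0\<close> in \<open>auto simp: e_def\<close>)
      then show ?thesis by (simp add: T_def S0)
    qed
    obtain \<zeta> where \<zeta>: "periodic_cont \<zeta>" "\<And>s. norm (\<zeta> s) \<le> \<rho>" "T \<zeta> = \<zeta>"
    proof (rule banach_fix_periodic[of \<rho> T])
      show "0 \<le> \<rho>" by fact
      show "periodic_cont (T f)" if "periodic_cont f" "\<And>s. norm (f s) \<le> \<rho>" for f
        using that unfolding T_def by (intro Sper perF pere)
      show "norm (T f s) \<le> \<rho>" if "periodic_cont f" "\<And>s. norm (f s) \<le> \<rho>" for f s
      proof -
        have "norm (T f s - T (\<lambda>_. 0) s) \<le> \<rho> / 2"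
          using that \<rho>(1) by (intro contr) auto
        then show ?thesis
          using T0[of s] norm_triangle_sub[of "T f s" "T (\<lambda>_. 0) s"] by (simp add: \<rho>_def)
      qed
      show "norm (T f s - T g s) \<le> d / 2"
        if "periodic_cont f" "\<And>s. norm (f s) \<le> \<rho>" "periodic_cont g" "\<And>s. norm (g s) \<le> \<rho>"
          "\<And>s. norm (f s - g s) \<le> d" for f g d s
        by (rule contr[OF that])
    next
      fix f assume "periodic_cont f" "\<And>s. norm (f s) \<le> \<rho>" "T f = f"
      then show thesis by (rule that)
    qed
    obtain c \<zeta>' \<zeta>'' where d: "\<And>s. (\<zeta> has_vector_derivative \<zeta>' s) (at s)" "\<And>s. (\<zeta>' has_vector_derivative \<zeta>'' s) (at s)"
      and ode: "\<And>s. complex_of_real (\<nu>\<^sup>2) * \<zeta>'' s + 2 * \<i> * complex_of_real \<nu> * \<zeta>' s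
         = complex_of_real ((1 + \<alpha>) * Re (\<zeta> s)) + F \<zeta> s - \<i> * complex_of_real c"
      using Sode[OF \<nu>2(2) perF[OF \<zeta>(1,2)] \<zeta>(1) \<zeta>(3)[symmetric, unfolded T_def e_def[abs_def]]] by blast
    define z where "z s = 1 + \<zeta> s" for s
    have dz: "(z has_vector_derivative \<zeta>' s) (at s)" for s
      unfolding z_def using d(1)[of s] by (auto intro!: derivative_eq_intros)
    have perz: "z (s + 2 * pi) = z s" for s
      using periodic_contD(2)[OF \<zeta>(1)] by (simp add: z_def)
    have odez: "complex_of_real (\<nu>\<^sup>2) * \<zeta>'' s + 2 * \<i> * complex_of_real \<nu> * \<zeta>' s
         = z s - grav \<alpha> (z s) + cis (- s) * p (cis s * z s) - \<i> * complex_of_real c" for s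
      unfolding ode by (simp add: F_def Q_def z_def)
    have half: "norm (\<zeta> s) \<le> 1 / 2" for s using \<zeta>(2)[of s] \<rho> \<rho>0 by linarith
    have "Re (z s) > 0" for s
      using abs_Re_le_cmod[of "\<zeta> s"] half[of s] by (simp add: z_def)
    then have "c = 0"
      using nb(1)[OF \<zeta>(2)] by (intro no_residual_force[OF dz d(2) perz _ _ pot odez]) (auto simp: z_def)
    then show "\<exists>z z' z''. (\<forall>s. (z has_vector_derivative z' s) (at s)) \<and> (\<forall>s. (z' has_vector_derivative z'' s) (at s)) \<and>
        (\<forall>s. z (s + 2 * pi) = z s) \<and> (\<forall>s. norm (z s - 1) \<le> 2 * C * \<Lambda>) \<and> (\<forall>s. norm (z s - 1) \<le> 1 / 2) \<and>
        (\<forall>s. complex_of_real (\<nu>\<^sup>2) * z'' s + 2 * \<i> * complex_of_real \<nu> * z' s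
          = z s - grav \<alpha> (z s) + cis (- s) * p (cis s * z s))"
      using dz d(2) perz odez half \<zeta>(2)
      by (intro exI[of _ z] exI[of _ \<zeta>'] exI[of _ \<zeta>'']) (auto simp: z_def \<rho>_def)
  qed
qed

section \<open>Tidal force of the other primaries\<close>

lemma grav_lipschitz:
  fixes b :: "'a::real_inner"
  assumes "b \<noteq> 0"
  obtains \<delta> L where "\<delta> > 0" "L-lipschitz_on (ball b \<delta>) (grav \<alpha>)" "0 \<notin> ball b \<delta>"
proof (rule grav_strict_derivative[OF assms zero_less_one, of \<alpha>])
  fix \<delta> :: real
  assume \<delta>: "\<delta> > 0" "0 \<notin> ball b \<delta>"
    and strict: "\<And>x y. x \<in> ball b \<delta> \<Longrightarrow> y \<in> ball b \<delta> \<Longrightarrow>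
      norm (grav \<alpha> x - grav \<alpha> y - grav_deriv \<alpha> b (x - y)) \<le> 1 * norm (x - y)"
  have "(onorm (grav_deriv \<alpha> b) + 1)-lipschitz_on (ball b \<delta>) (grav \<alpha>)"
  proof (rule lipschitz_onI)
    show "0 \<le> onorm (grav_deriv \<alpha> b) + 1"
      using onorm_pos_le[OF bounded_linear_grav_deriv, of \<alpha> b] by simp
    fix x y assume "x \<in> ball b \<delta>" "y \<in> ball b \<delta>"
    from strict[OF this] onorm[OF bounded_linear_grav_deriv, of \<alpha> b "x - y"]
    have "norm (grav \<alpha> x - grav \<alpha> y) \<le> onorm (grav_deriv \<alpha> b) * norm (x - y) + norm (x - y)"
      using norm_triangle_sub[of "grav \<alpha> x - grav \<alpha> y" "grav_deriv \<alpha> b (x - y)"] by linarith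
    then show "dist (grav \<alpha> x) (grav \<alpha> y) \<le> (onorm (grav_deriv \<alpha> b) + 1) * dist x y"
      by (simp add: dist_norm algebra_simps)
  qed
  then show thesis using that \<delta> by blast
qed

text \<open>With \<open>b j\<close> the first primary's position relative to the
  \<open>j\<close>-th, this is the pull of the others at offset \<open>w\<close> minus their pull on
  the first primary itself. Subtracting the latter makes the perturbation proportional to the
  offset.\<close>

definition tidal :: "real \<Rightarrow> ('i \<Rightarrow> real) \<Rightarrow> ('i \<Rightarrow> 'a) \<Rightarrow> 'i set \<Rightarrow> 'a::real_inner \<Rightarrow> 'a" where
  "tidal \<alpha> m b J w = - (\<Sum>j\<in>J. m j *\<^sub>R (grav \<alpha> (b j + w) - grav \<alpha> (b j)))"

lemma tidal_0: "tidal \<alpha> m b J 0 = 0"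
  by (simp add: tidal_def)

lemma tidal_insert:
  assumes "finite J" "i \<notin> J"
  shows "tidal \<alpha> m b (insert i J) w = - (m i) *\<^sub>R (grav \<alpha> (b i + w) - grav \<alpha> (b i)) + tidal \<alpha> m b J w"
  using assms by (simp add: tidal_def)

lemma tidal_lipschitz:
  fixes b :: "'i \<Rightarrow> 'a::real_inner"
  assumes "finite J" "\<And>j. j \<in> J \<Longrightarrow> b j \<noteq> 0"
  shows "\<exists>\<delta> L. \<delta> > 0 \<and> L-lipschitz_on (ball 0 \<delta>) (tidal \<alpha> m b J) \<and> (\<forall>j\<in>J. \<forall>w. norm w < \<delta> \<longrightarrow> b j + w \<noteq> 0)"
  using assms
proof (induction J rule: finite_induct)
  case empty
  have "0-lipschitz_on (ball 0 1) (tidal \<alpha> m b {})"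
    by (auto simp: tidal_def intro!: lipschitz_onI)
  then show ?case by (intro exI[of _ "1::real"] exI[of _ "0::real"]) auto
next
  case (insert i J)
  then obtain \<delta> L where \<delta>: "\<delta> > 0" and L: "L-lipschitz_on (ball 0 \<delta>) (tidal \<alpha> m b J)"
    and nz: "\<forall>j\<in>J. \<forall>w. norm w < \<delta> \<longrightarrow> b j + w \<noteq> 0" by auto
  obtain \<delta>' L' where \<delta>': "\<delta>' > 0" and L': "L'-lipschitz_on (ball (b i) \<delta>') (grav \<alpha>)" and nz': "0 \<notin> ball (b i) \<delta>'"
    using grav_lipschitz[of "b i" \<alpha>] insert.prems by blast
  define \<delta>'' where "\<delta>'' = min \<delta> \<delta>'"
  have "(\<bar>m i\<bar> * L')-lipschitz_on (ball 0 \<delta>'') (\<lambda>w. - (m i) *\<^sub>R (grav \<alpha> (b i + w) - grav \<alpha> (b i)))"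
  proof (rule lipschitz_onI)
    show "0 \<le> \<bar>m i\<bar> * L'" using lipschitz_on_nonneg[OF L'] by simp
    fix x y :: 'a assume "x \<in> ball 0 \<delta>''" "y \<in> ball 0 \<delta>''"
    then have "dist (grav \<alpha> (b i + x)) (grav \<alpha> (b i + y)) \<le> L' * dist (b i + x) (b i + y)"
      by (intro lipschitz_onD[OF L']) (auto simp: \<delta>''_def dist_norm)
    from mult_left_mono[OF this, of "\<bar>m i\<bar>"]
    show "dist (- (m i) *\<^sub>R (grav \<alpha> (b i + x) - grav \<alpha> (b i))) (- (m i) *\<^sub>R (grav \<alpha> (b i + y) - grav \<alpha> (b i)))
      \<le> \<bar>m i\<bar> * L' * dist x y"
      by (simp add: dist_norm norm_minus_commute mult.assoc flip: scaleR_diff_right)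
  qed
  moreover have "L-lipschitz_on (ball 0 \<delta>'') (tidal \<alpha> m b J)"
    by (rule lipschitz_on_subset[OF L]) (auto simp: \<delta>''_def)
  ultimately have "(\<bar>m i\<bar> * L' + L)-lipschitz_on (ball 0 \<delta>'') (tidal \<alpha> m b (insert i J))"
    unfolding tidal_insert[OF insert.hyps, abs_def] by (rule lipschitz_on_add)
  moreover have "b i + w \<noteq> 0" if "norm w < \<delta>''" for w
  proof -
    have "b i + w \<in> ball (b i) \<delta>'" using that by (auto simp: \<delta>''_def dist_norm)
    then show ?thesis using nz' by metis
  qed
  moreover have "\<forall>j\<in>J. \<forall>w. norm w < \<delta>'' \<longrightarrow> b j + w \<noteq> 0" using nz by (simp add: \<delta>''_def)
  moreover have "\<delta>'' > 0" using \<delta> \<delta>' by (simp add: \<delta>''_def)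
  ultimately show ?case by (intro exI[of _ \<delta>''] exI) auto
qed

lemma tidal_potential:
  fixes b :: "'i \<Rightarrow> 'a::real_inner"
  obtains V where "\<And>w. (\<And>j. j \<in> J \<Longrightarrow> b j + w \<noteq> 0) \<Longrightarrow> (V has_derivative (\<lambda>h. tidal \<alpha> m b J w \<bullet> h)) (at w)"
proof -
  obtain U where U: "\<And>x::'a. x \<noteq> 0 \<Longrightarrow> (U has_derivative (\<lambda>h. grav \<alpha> x \<bullet> h)) (at x)"
    using grav_potential by blast
  show thesis
  proof (rule that[of "\<lambda>w. - (\<Sum>j\<in>J. m j * (U (b j + w) - grav \<alpha> (b j) \<bullet> w))"])
    fix w assume nz: "\<And>j. j \<in> J \<Longrightarrow> b j + w \<noteq> 0"
    have "((\<lambda>w. - (\<Sum>j\<in>J. m j * (U (b j + w) - grav \<alpha> (b j) \<bullet> w))) has_derivative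
      (\<lambda>h. - (\<Sum>j\<in>J. m j * (grav \<alpha> (b j + w) \<bullet> h - grav \<alpha> (b j) \<bullet> h)))) (at w)"
    proof (intro has_derivative_minus has_derivative_sum has_derivative_mult_right has_derivative_diff)
      fix j assume "j \<in> J"
      have "((\<lambda>w. b j + w) has_derivative (\<lambda>h. h)) (at w)"
        by (auto intro!: derivative_eq_intros)
      from has_derivative_compose[OF this U[OF nz[OF \<open>j \<in> J\<close>]]]
      show "((\<lambda>w. U (b j + w)) has_derivative (\<lambda>h. grav \<alpha> (b j + w) \<bullet> h)) (at w)" .
      show "((\<lambda>w. grav \<alpha> (b j) \<bullet> w) has_derivative (\<lambda>h. grav \<alpha> (b j) \<bullet> h)) (at w)"
        by (rule bounded_linear_imp_has_derivative[OF bounded_linear_inner_right])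
    qed
    then show "((\<lambda>w. - (\<Sum>j\<in>J. m j * (U (b j + w) - grav \<alpha> (b j) \<bullet> w))) has_derivative
        (\<lambda>h. tidal \<alpha> m b J w \<bullet> h)) (at w)"
      by (simp add: tidal_def inner_sum_left inner_diff_left)
  qed
qed

text \<open>In the frame rotating with the primaries, changing \<open>\<theta>\<close> is a translation of time.\<close>

definition satellite_path :: "real \<Rightarrow> real \<Rightarrow> (real \<Rightarrow> complex) \<Rightarrow> real \<Rightarrow> real \<Rightarrow> complex" where
  "satellite_path \<omega> \<epsilon> z \<theta> t = \<epsilon> *\<^sub>R (cis (\<omega> * t + \<theta>) * z ((\<omega> - 1) * t + \<theta>))"

text \<open>The hypothesis
  \<open>\<epsilon> * \<omega>\<^sup>2 = \<epsilon> powr (- \<alpha>)\<close> is Kepler's third law: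
  on a circle of radius \<epsilon> run at angular speed \<omega>, the centripetal acceleration
  equals the attraction of a unit mass at the centre. Dividing the equation by this common value
  gives \<open>f\<close> its factor \<open>\<epsilon> powr \<alpha>\<close>.\<close>

lemma rotating_to_inertial:
  fixes z z' z'' :: "real \<Rightarrow> complex" and \<omega> \<epsilon> \<nu> \<alpha> \<theta> :: real
  assumes \<omega>: "\<omega> > 0" and \<epsilon>: "\<epsilon> > 0" "\<epsilon> * \<omega>\<^sup>2 = \<epsilon> powr (- \<alpha>)" and \<nu>: "\<omega> * \<nu> = \<omega> - 1"
    and z: "\<And>s. (z has_vector_derivative z' s) (at s)" "\<And>s. (z' has_vector_derivative z'' s) (at s)"
    and ode: "\<And>s. complex_of_real (\<nu>\<^sup>2) * z'' s + 2 * \<i> * complex_of_real \<nu> * z' s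
       = z s - grav \<alpha> (z s) + cis (- s) * (\<epsilon> powr \<alpha> *\<^sub>R f (\<epsilon> *\<^sub>R (cis s * z s)))"
  defines "u \<equiv> satellite_path \<omega> \<epsilon> z \<theta>"
  obtains u' where "\<And>t. (u has_vector_derivative u' t) (at t)"
    "\<And>t. (u' has_vector_derivative - grav \<alpha> (u t) + cis t * f (cis (- t) * u t)) (at t)"
proof -
  define \<sigma> where "\<sigma> t = (\<omega> - 1) * t + \<theta>" for t
  define e where "e t = cis (\<omega> * t + \<theta>)" for t
  have de: "(e has_vector_derivative \<i> * complex_of_real \<omega> * e t) (at t)" for t
    unfolding e_def has_vector_derivative_complex_iff
    by (auto simp flip: has_real_derivative_iff_has_vector_derivative intro!: derivative_eq_intros)
  have d\<sigma>: "(\<sigma> has_vector_derivative (\<omega> - 1)) (at t)" for t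
    unfolding \<sigma>_def
    by (auto simp flip: has_real_derivative_iff_has_vector_derivative intro!: derivative_eq_intros)
  have dz: "((\<lambda>t. z (\<sigma> t)) has_vector_derivative complex_of_real (\<omega> - 1) * z' (\<sigma> t)) (at t)" for t
    using vector_diff_chain_at[OF d\<sigma> z(1)] by (simp add: o_def scaleR_conv_of_real)
  have dz': "((\<lambda>t. z' (\<sigma> t)) has_vector_derivative complex_of_real (\<omega> - 1) * z'' (\<sigma> t)) (at t)" for t
    using vector_diff_chain_at[OF d\<sigma> z(2)] by (simp add: o_def scaleR_conv_of_real)
  have u: "u = (\<lambda>t. complex_of_real \<epsilon> * (e t * z (\<sigma> t)))"
    by (simp add: u_def satellite_path_def[abs_def] e_def \<sigma>_def scaleR_conv_of_real)
  define u' where "u' t = complex_of_real \<epsilon> * (e t * (\<i> * complex_of_real \<omega> * z (\<sigma> t) + complex_of_real (\<omega> - 1) * z' (\<sigma> t)))" for t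
  show thesis
  proof (rule that[of u'])
    fix t
    show "(u has_vector_derivative u' t) (at t)"
      unfolding u u'_def by (auto intro!: derivative_eq_intros de dz simp: algebra_simps)
    \<comment> \<open>As \<open>\<omega> * t + \<theta> = t + \<sigma> t\<close>, the phase splits
      into the rotation of the frame and the phase seen within it.\<close>
    have cis_eq: "e t = cis t * cis (\<sigma> t)" "cis (- t) * e t = cis (\<sigma> t)" "e t * cis (- \<sigma> t) = cis t"
      by (simp_all add: e_def \<sigma>_def cis_mult algebra_simps)
    have "(u' has_vector_derivative complex_of_real \<epsilon> * (e t * (- complex_of_real (\<omega>\<^sup>2) * z (\<sigma> t)
        + 2 * \<i> * complex_of_real (\<omega> * (\<omega> - 1)) * z' (\<sigma> t) + complex_of_real ((\<omega> - 1)\<^sup>2) * z'' (\<sigma> t)))) (at t)"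
      unfolding u'_def by (auto intro!: derivative_eq_intros de dz dz' simp: algebra_simps power2_eq_square)
    moreover have "complex_of_real \<epsilon> * (e t * (- complex_of_real (\<omega>\<^sup>2) * z (\<sigma> t)
        + 2 * \<i> * complex_of_real (\<omega> * (\<omega> - 1)) * z' (\<sigma> t) + complex_of_real ((\<omega> - 1)\<^sup>2) * z'' (\<sigma> t)))
      = - grav \<alpha> (u t) + cis t * f (cis (- t) * u t)"
    proof -
      have "complex_of_real \<epsilon> * (e t * (- complex_of_real (\<omega>\<^sup>2) * z (\<sigma> t)
          + 2 * \<i> * complex_of_real (\<omega> * (\<omega> - 1)) * z' (\<sigma> t) + complex_of_real ((\<omega> - 1)\<^sup>2) * z'' (\<sigma> t)))
        = complex_of_real (\<epsilon> * \<omega>\<^sup>2) * (e t * (complex_of_real (\<nu>\<^sup>2) * z'' (\<sigma> t) + 2 * \<i> * complex_of_real \<nu> * z' (\<sigma> t) - z (\<sigma> t)))"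
        unfolding \<nu>[symmetric] by (simp add: algebra_simps power2_eq_square)
      also have "\<dots> = complex_of_real (\<epsilon> powr - \<alpha>) * (e t * (- grav \<alpha> (z (\<sigma> t))))
          + (\<epsilon> powr - \<alpha> * \<epsilon> powr \<alpha>) *\<^sub>R (e t * cis (- \<sigma> t) * f (\<epsilon> *\<^sub>R (cis (\<sigma> t) * z (\<sigma> t))))"
        unfolding ode \<epsilon>(2) by (simp add: scaleR_conv_of_real algebra_simps)
      also have "\<epsilon> powr - \<alpha> * \<epsilon> powr \<alpha> = 1" using \<epsilon>(1) by (simp flip: powr_add)
      also have "complex_of_real (\<epsilon> powr - \<alpha>) * (e t * (- grav \<alpha> (z (\<sigma> t)))) = - grav \<alpha> (u t)"
      proof -
        have "u t = \<epsilon> *\<^sub>R (cis (\<omega> * t + \<theta>) * z (\<sigma> t))" by (simp add: u_def satellite_path_def \<sigma>_def)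
        then have "grav \<alpha> (u t) = \<epsilon> powr - \<alpha> *\<^sub>R (e t * grav \<alpha> (z (\<sigma> t)))"
          by (simp only: grav_scaleR[OF \<epsilon>(1)] grav_cis_mult e_def)
        then show ?thesis by (simp add: scaleR_conv_of_real)
      qed
      also have "\<epsilon> *\<^sub>R (cis (\<sigma> t) * z (\<sigma> t)) = cis (- t) * u t"
        unfolding u cis_eq(2)[symmetric] by (simp add: scaleR_conv_of_real algebra_simps)
      finally show ?thesis by (simp add: cis_eq(3))
    qed
    ultimately show "(u' has_vector_derivative - grav \<alpha> (u t) + cis t * f (cis (- t) * u t)) (at t)"
      by simp
  qed
qed

lemma satellite_orbits:
  fixes \<alpha> :: real and b :: "'i \<Rightarrow> complex"
  assumes \<alpha>: "\<alpha> \<ge> 1" "\<alpha> \<noteq> 2" and J: "finite J" "\<And>j. j \<in> J \<Longrightarrow> b j \<noteq> 0"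
  obtains C \<omega>0 :: real where "\<omega>0 \<ge> 1"
    "\<And>\<omega> \<epsilon>. \<omega> > \<omega>0 \<Longrightarrow> \<epsilon> = \<omega> powr (- 2 / (\<alpha> + 1)) \<Longrightarrow>
      \<exists>z. (\<forall>s. z (s + 2 * pi) = z s) \<and> (\<forall>s. norm (z s - 1) \<le> 1 / 2) \<and> (\<forall>s. norm (z s - 1) \<le> C * \<epsilon>\<^sup>2) \<and>
        (\<forall>\<theta>. (\<forall>t. satellite_path \<omega> \<epsilon> z \<theta> t \<noteq> 0) \<and>
          (\<forall>t. \<forall>j\<in>J. b j + cis (- t) * satellite_path \<omega> \<epsilon> z \<theta> t \<noteq> 0) \<and>
          (\<exists>u'. \<forall>t. (satellite_path \<omega> \<epsilon> z \<theta> has_vector_derivative u' t) (at t) \<and>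
            (u' has_vector_derivative - grav \<alpha> (satellite_path \<omega> \<epsilon> z \<theta> t)
              + cis t * tidal \<alpha> m b J (cis (- t) * satellite_path \<omega> \<epsilon> z \<theta> t)) (at t)))"
proof -
  obtain C \<Lambda>0 \<nu>0 where C: "C > 0" and \<Lambda>0: "\<Lambda>0 > 0" and \<nu>0: "\<nu>0 < 1" and orbit:
    "\<And>\<Lambda> \<nu> p V. \<Lambda> \<le> \<Lambda>0 \<Longrightarrow> \<nu>0 \<le> \<nu> \<Longrightarrow> \<nu> \<le> 1 \<Longrightarrow> p 0 = 0 \<Longrightarrow> \<Lambda>-lipschitz_on (ball 0 2) p \<Longrightarrow>
      (\<And>w. norm w < 2 \<Longrightarrow> (V has_derivative (\<lambda>h. p w \<bullet> h)) (at w)) \<Longrightarrow>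
      \<exists>z z' z''. (\<forall>s. (z has_vector_derivative z' s) (at s)) \<and> (\<forall>s. (z' has_vector_derivative z'' s) (at s)) \<and>
        (\<forall>s. z (s + 2 * pi) = z s) \<and> (\<forall>s. norm (z s - 1) \<le> C * \<Lambda>) \<and> (\<forall>s. norm (z s - 1) \<le> 1 / 2) \<and>
        (\<forall>s. complex_of_real (\<nu>\<^sup>2) * z'' s + 2 * \<i> * complex_of_real \<nu> * z' s
          = z s - grav \<alpha> (z s) + cis (- s) * p (cis s * z s))"
  proof (rule periodic_satellite_orbit[OF \<alpha>], goal_cases)
    case (1 C \<Lambda>0 \<nu>0)
    show thesis by (rule 1(1)) (fact 1(2-5))+
  qed
  obtain \<delta> L where \<delta>: "\<delta> > 0" and L: "L-lipschitz_on (ball 0 \<delta>) (tidal \<alpha> m b J)"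
    and nz: "\<And>j w. j \<in> J \<Longrightarrow> norm w < \<delta> \<Longrightarrow> b j + w \<noteq> 0"
    using tidal_lipschitz[where b = b and m = m and \<alpha> = \<alpha>, OF J] by blast
  obtain V where V: "\<And>w. (\<And>j. j \<in> J \<Longrightarrow> b j + w \<noteq> 0) \<Longrightarrow> (V has_derivative (\<lambda>h. tidal \<alpha> m b J w \<bullet> h)) (at w)"
    using tidal_potential by blast
  have "L \<ge> 0" using L by (rule lipschitz_on_nonneg)
  have lim_eps: "((\<lambda>\<omega>. \<omega> powr (- 2 / (\<alpha> + 1))) \<longlongrightarrow> 0) at_top"
    using \<alpha> by (intro tendsto_neg_powr filterlim_ident) (auto simp: divide_less_0_iff)
  have lim2: "((\<lambda>\<omega>. L * \<omega> powr (- 2)) \<longlongrightarrow> 0) at_top"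
    by (rule tendsto_mult_right_zero, rule tendsto_neg_powr) (auto simp: filterlim_ident)
  have lim_nu: "((\<lambda>\<omega>::real. 1 - 1 / \<omega>) \<longlongrightarrow> 1 - 0) at_top"
    by (intro tendsto_intros tendsto_divide_0[OF tendsto_const] filterlim_at_top_imp_at_infinity filterlim_ident)
  \<comment> \<open>The bound \<epsilon> < \<delta> / 2 puts the disc of radius 2, scaled by
    \<epsilon>, inside the domain of the tidal estimates; \<epsilon> < 1 allows powers of \<epsilon>
    to be compared.\<close>
  have "\<forall>\<^sub>F \<omega> in at_top. \<omega> powr (- 2 / (\<alpha> + 1)) < min 1 (\<delta> / 2) \<and> L * \<omega> powr (- 2) < \<Lambda>0 \<and> \<nu>0 < 1 - 1 / \<omega>"
    using \<delta> \<Lambda>0 \<nu>0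
    by (intro eventually_conj order_tendstoD(2)[OF lim_eps] order_tendstoD(2)[OF lim2] order_tendstoD(1)[OF lim_nu]) auto
  then obtain \<omega>1 where \<omega>1: "\<And>\<omega>. \<omega> \<ge> \<omega>1 \<Longrightarrow> \<omega> powr (- 2 / (\<alpha> + 1)) < min 1 (\<delta> / 2) \<and> L * \<omega> powr (- 2) < \<Lambda>0 \<and> \<nu>0 < 1 - 1 / \<omega>"
    by (auto simp: eventually_at_top_linorder)
  show thesis
  proof (rule that[of "max 1 \<omega>1" "C * L"])
    show "1 \<le> max 1 \<omega>1" by simp
    fix \<omega> \<epsilon> :: real
    assume "\<omega> > max 1 \<omega>1" and \<epsilon>_def: "\<epsilon> = \<omega> powr (- 2 / (\<alpha> + 1))"
    then have \<omega>: "\<omega> > 1" and \<epsilon>: "\<epsilon> < 1" "\<epsilon> < \<delta> / 2" and small: "L * \<omega> powr (- 2) < \<Lambda>0" "\<nu>0 < 1 - 1 / \<omega>"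
      using \<omega>1[of \<omega>] by auto
    have "\<epsilon> > 0" using \<omega> by (simp add: \<epsilon>_def)
    have eps_pow: "\<epsilon> powr (\<alpha> + 1) = \<omega> powr (- 2)"
    proof -
      have "- 2 / (\<alpha> + 1) * (\<alpha> + 1) = - 2" using \<alpha> by (simp add: field_simps)
      then show ?thesis by (simp only: \<epsilon>_def powr_powr)
    qed
    have "\<epsilon> * \<omega>\<^sup>2 = \<epsilon> powr (- \<alpha>)"
    proof -
      have "\<epsilon> powr (- \<alpha>) = \<epsilon> powr (1 - (\<alpha> + 1))" by simp
      also have "\<dots> = \<epsilon> / \<epsilon> powr (\<alpha> + 1)" using \<open>\<epsilon> > 0\<close> by (subst powr_diff) simp
      also have "\<dots> = \<epsilon> * \<omega>\<^sup>2" unfolding eps_pow using \<omega> by (simp add: powr_minus powr_numeral field_simps)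
      finally show ?thesis by simp
    qed
    define \<nu> where "\<nu> = 1 - 1 / \<omega>"
    define p where "p w = \<epsilon> powr \<alpha> *\<^sub>R tidal \<alpha> m b J (\<epsilon> *\<^sub>R w)" for w
    have in_ball: "norm (\<epsilon> *\<^sub>R w) < \<delta>" if "norm w < 2" for w :: complex
    proof -
      have "\<epsilon> * norm w \<le> \<epsilon> * 2" using that \<open>\<epsilon> > 0\<close> by simp
      then have "\<epsilon> * norm w < \<delta>" using \<epsilon>(2) by linarith
      then show ?thesis using \<open>\<epsilon> > 0\<close> by simp
    qed
    have "(L * \<epsilon> powr (\<alpha> + 1))-lipschitz_on (ball 0 2) p"
    proof (rule lipschitz_onI)
      show "0 \<le> L * \<epsilon> powr (\<alpha> + 1)" using \<open>L \<ge> 0\<close> by simp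
      fix x y :: complex assume "x \<in> ball 0 2" "y \<in> ball 0 2"
      then have "dist (tidal \<alpha> m b J (\<epsilon> *\<^sub>R x)) (tidal \<alpha> m b J (\<epsilon> *\<^sub>R y)) \<le> L * dist (\<epsilon> *\<^sub>R x) (\<epsilon> *\<^sub>R y)"
        using in_ball[of x] in_ball[of y] by (intro lipschitz_onD[OF L]) auto
      from mult_left_mono[OF this, of "\<epsilon> powr \<alpha>"]
      show "dist (p x) (p y) \<le> L * \<epsilon> powr (\<alpha> + 1) * dist x y"
        using \<open>\<epsilon> > 0\<close> by (simp add: p_def dist_norm powr_add algebra_simps flip: scaleR_diff_right)
    qed
    \<comment> \<open>The exponent is \<open>\<alpha> - 1\<close> because the chain rule supplies
      the remaining factor \<epsilon>.\<close>
    moreover have "((\<lambda>w. \<epsilon> powr (\<alpha> - 1) * V (\<epsilon> *\<^sub>R w)) has_derivative (\<lambda>h. p w \<bullet> h)) (at w)" if "norm w < 2" for w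
    proof -
      have "(V has_derivative (\<lambda>h. tidal \<alpha> m b J (\<epsilon> *\<^sub>R w) \<bullet> h)) (at (\<epsilon> *\<^sub>R w))"
        using in_ball[OF that] nz by (intro V) auto
      from has_derivative_compose[OF bounded_linear_imp_has_derivative[OF bounded_linear_scaleR_right] this]
      have "((\<lambda>w. \<epsilon> powr (\<alpha> - 1) * V (\<epsilon> *\<^sub>R w)) has_derivative
          (\<lambda>h. \<epsilon> powr (\<alpha> - 1) * (tidal \<alpha> m b J (\<epsilon> *\<^sub>R w) \<bullet> (\<epsilon> *\<^sub>R h)))) (at w)"
        by (rule has_derivative_mult_right)
      moreover have "\<epsilon> powr \<alpha> = \<epsilon> powr (\<alpha> - 1) * \<epsilon>" using \<open>\<epsilon> > 0\<close> by (simp add: powr_diff)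
      ultimately show ?thesis by (simp add: p_def mult.assoc)
    qed
    ultimately obtain z z' z'' where
      z: "\<And>s. (z has_vector_derivative z' s) (at s)" "\<And>s. (z' has_vector_derivative z'' s) (at s)"
      and per: "\<And>s. z (s + 2 * pi) = z s" and bound: "\<And>s. norm (z s - 1) \<le> C * (L * \<epsilon> powr (\<alpha> + 1))"
      and half: "\<And>s. norm (z s - 1) \<le> 1 / 2"
      and ode: "\<And>s. complex_of_real (\<nu>\<^sup>2) * z'' s + 2 * \<i> * complex_of_real \<nu> * z' s
          = z s - grav \<alpha> (z s) + cis (- s) * p (cis s * z s)"
      using orbit[of "L * \<epsilon> powr (\<alpha> + 1)" \<nu> p "\<lambda>w. \<epsilon> powr (\<alpha> - 1) * V (\<epsilon> *\<^sub>R w)"] small \<omega>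
      by (auto simp: eps_pow p_def tidal_0 \<nu>_def)
    have zn: "z s \<noteq> 0" "norm (z s) < 2" for s
      using half[of s] norm_triangle_sub[of "z s" 1] by auto
    have "norm (z s - 1) \<le> C * L * \<epsilon>\<^sup>2" for s
    proof -
      \<comment> \<open>Here \<alpha> \<ge> 1 and \<epsilon> < 1 give the order
        \<open>\<epsilon>\<^sup>2\<close> of the deviation in \<open>z\<close>.\<close>
      have "\<epsilon> powr (\<alpha> + 1) \<le> \<epsilon> powr 2" using \<alpha> \<epsilon> \<open>\<epsilon> > 0\<close> by (intro powr_mono') auto
      then have "C * (L * \<epsilon> powr (\<alpha> + 1)) \<le> C * (L * \<epsilon>\<^sup>2)"
        using C \<open>L \<ge> 0\<close> \<open>\<epsilon> > 0\<close> by (intro mult_left_mono) (auto simp: powr_numeral)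
      then show ?thesis using bound[of s] by (simp add: mult.assoc)
    qed
    moreover have "(\<forall>t. satellite_path \<omega> \<epsilon> z \<theta> t \<noteq> 0) \<and>
          (\<forall>t. \<forall>j\<in>J. b j + cis (- t) * satellite_path \<omega> \<epsilon> z \<theta> t \<noteq> 0) \<and>
          (\<exists>u'. \<forall>t. (satellite_path \<omega> \<epsilon> z \<theta> has_vector_derivative u' t) (at t) \<and>
            (u' has_vector_derivative - grav \<alpha> (satellite_path \<omega> \<epsilon> z \<theta> t)
              + cis t * tidal \<alpha> m b J (cis (- t) * satellite_path \<omega> \<epsilon> z \<theta> t)) (at t))" for \<theta>
    proof (intro conjI allI ballI)
      fix t
      show "satellite_path \<omega> \<epsilon> z \<theta> t \<noteq> 0" using zn \<open>\<epsilon> > 0\<close> by (simp add: satellite_path_def)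
      have "cis (- t) * satellite_path \<omega> \<epsilon> z \<theta> t = \<epsilon> *\<^sub>R (cis (- t) * (cis (\<omega> * t + \<theta>) * z ((\<omega> - 1) * t + \<theta>)))"
        by (simp add: satellite_path_def)
      then have "norm (cis (- t) * satellite_path \<omega> \<epsilon> z \<theta> t) < \<delta>"
        using in_ball[of "cis (- t) * (cis (\<omega> * t + \<theta>) * z ((\<omega> - 1) * t + \<theta>))"] zn
        by (simp only: norm_mult norm_cis mult_1)
      then show "b j + cis (- t) * satellite_path \<omega> \<epsilon> z \<theta> t \<noteq> 0" if "j \<in> J" for j
        using nz that by blast
    next
      have "\<omega> * \<nu> = \<omega> - 1" using \<omega> by (simp add: \<nu>_def field_simps)
      show "\<exists>u'. \<forall>t. (satellite_path \<omega> \<epsilon> z \<theta> has_vector_derivative u' t) (at t) \<and>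
            (u' has_vector_derivative - grav \<alpha> (satellite_path \<omega> \<epsilon> z \<theta> t) + cis t * tidal \<alpha> m b J (cis (- t) * satellite_path \<omega> \<epsilon> z \<theta> t)) (at t)"
        by (rule rotating_to_inertial[OF _ \<open>\<epsilon> > 0\<close> \<open>\<epsilon> * \<omega>\<^sup>2 = \<epsilon> powr (- \<alpha>)\<close> \<open>\<omega> * \<nu> = \<omega> - 1\<close> z
              ode[unfolded p_def], of \<theta>]) (use \<omega> in auto)
    qed
    ultimately show "\<exists>z. (\<forall>s. z (s + 2 * pi) = z s) \<and> (\<forall>s. norm (z s - 1) \<le> 1 / 2) \<and> (\<forall>s. norm (z s - 1) \<le> C * L * \<epsilon>\<^sup>2) \<and>
        (\<forall>\<theta>. (\<forall>t. satellite_path \<omega> \<epsilon> z \<theta> t \<noteq> 0) \<and>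
          (\<forall>t. \<forall>j\<in>J. b j + cis (- t) * satellite_path \<omega> \<epsilon> z \<theta> t \<noteq> 0) \<and>
          (\<exists>u'. \<forall>t. (satellite_path \<omega> \<epsilon> z \<theta> has_vector_derivative u' t) (at t) \<and>
            (u' has_vector_derivative - grav \<alpha> (satellite_path \<omega> \<epsilon> z \<theta> t)
              + cis t * tidal \<alpha> m b J (cis (- t) * satellite_path \<omega> \<epsilon> z \<theta> t)) (at t)))"
      using per half by (intro exI[of _ z]) blast
  qed
qed

section \<open>Transfer to the plane\<close>

text \<open>\<open>expJ \<theta>\<close> rotates clockwise, so the identification with the complex plane is orientation reversing.\<close>

definition plane :: "complex \<Rightarrow> real^2" where
  "plane z = vector [Re z, - Im z]"

definition unplane :: "real^2 \<Rightarrow> complex" where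
  "unplane v = Complex (v $ 1) (- (v $ 2))"

lemma plane_unplane [simp]: "plane (unplane v) = v"
  by (simp add: plane_def unplane_def vec_eq_iff forall_2)

lemma linear_plane: "linear plane"
  by (rule linearI) (simp_all add: plane_def vec_eq_iff forall_2)

lemma bounded_linear_plane: "bounded_linear plane"
  using linear_plane by (simp add: linear_conv_bounded_linear)

lemma linear_unplane: "linear unplane"
  by (rule linearI) (simp_all add: unplane_def complex_eq_iff)

lemma norm_plane [simp]: "norm (plane z) = norm z"
  by (simp add: plane_def norm_vec_def L2_set_def sum_2 cmod_def)

lemma grav_plane: "grav \<alpha> (plane z) = plane (grav \<alpha> z)"
  by (simp add: grav_def linear_cmul[OF linear_plane])

lemma expJ_plane: "expJ \<theta> *v plane z = plane (cis \<theta> * z)"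
  by (simp add: expJ_def plane_def Jmat_def mat_def matrix_vector_mult_def vec_eq_iff forall_2 sum_2 algebra_simps)

lemma x0_plane: "x0 = plane 1"
  by (simp add: x0_def plane_def)

lemma primary_plane: "primary a j t = plane (cis t * unplane (a j))"
  by (metis primary_def expJ_plane plane_unplane)

lemma periodic_int_multiple:
  fixes z :: "real \<Rightarrow> 'a"
  assumes per: "\<And>s. z (s + 2 * pi) = z s"
  shows "z (s + 2 * pi * of_int k) = z s"
proof (induction k arbitrary: s rule: int_induct[where k = 0])
  case base
  show ?case by simp
next
  case (step1 i)
  then show ?case using per[of "s + 2 * pi * of_int i"] by (simp add: algebra_simps)
next
  case (step2 i)
  then show ?case using per[of "s + 2 * pi * of_int (i - 1)"] by (simp add: algebra_simps)
qed

lemma cis_int_multiple: "cis (s + 2 * pi * of_int k) = cis s"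
  by (rule periodic_int_multiple) (simp add: complex_eq_iff)

section \<open>Equations of motion of the restricted problem in complex coordinates\<close>

lemma central_config_unplane:
  assumes "central_config n m \<alpha> a" "n \<ge> 2"
  defines "b \<equiv> \<lambda>j. unplane (a 1 - a j)"
  shows "unplane (a 1) = (\<Sum>j\<in>{1..n} - {1}. m j *\<^sub>R grav \<alpha> (b j))"
proof -
  have "plane (\<Sum>j\<in>{1..n} - {1}. m j *\<^sub>R grav \<alpha> (b j)) = (\<Sum>j\<in>{1..n} - {1}. m j *\<^sub>R grav \<alpha> (a 1 - a j))"
    by (simp add: linear_sum[OF linear_plane] linear_cmul[OF linear_plane] b_def flip: grav_plane)
  also have "\<dots> = (\<Sum>j\<in>{1..n} - {1}. (m j / norm (a 1 - a j) powr (\<alpha> + 1)) *\<^sub>R (a 1 - a j))"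
    by (simp add: grav_def)
  also have "\<dots> = a 1"
    using assms(1,2) by (simp add: central_config_def)
  finally have "plane (\<Sum>j\<in>{1..n} - {1}. m j *\<^sub>R grav \<alpha> (b j)) = plane (unplane (a 1))" by simp
  moreover have "inj plane"
    by (auto intro!: injI simp: plane_def vec_eq_iff forall_2 complex_eq_iff)
  ultimately show ?thesis by (metis injD)
qed

text \<open>The tidal force differs from the full attraction of the other primaries by
  \<open>cis t * A\<close>. By the central configuration equation this is the opposite of the first
  primary's acceleration, so the two cancel in \<open>q''\<close>.\<close>

lemma restricted_solution_plane:
  fixes a :: "nat \<Rightarrow> real^2" and u u' :: "real \<Rightarrow> complex"
  assumes n: "n \<ge> 2" and m1: "m 1 = 1" and cc: "central_config n m \<alpha> a"
  defines "b \<equiv> \<lambda>j. unplane (a 1 - a j)"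
  defines "J \<equiv> {1..n} - {1}"
  assumes u0: "\<And>t. u t \<noteq> 0" and nz: "\<And>t j. j \<in> J \<Longrightarrow> b j + cis (- t) * u t \<noteq> 0"
    and du: "\<And>t. (u has_vector_derivative u' t) (at t)"
    and du': "\<And>t. (u' has_vector_derivative - grav \<alpha> (u t) + cis t * tidal \<alpha> m b J (cis (- t) * u t)) (at t)"
  shows "restricted_solution n m \<alpha> (primary a) (\<lambda>t. primary a 1 t + plane (u t))"
proof -
  define q where "q t = primary a 1 t + plane (u t)" for t
  define A where "A = unplane (a 1)"
  define v where "v t = plane (\<i> * cis t * A + u' t)" for t
  have A: "A = (\<Sum>j\<in>J. m j *\<^sub>R grav \<alpha> (b j))"
    unfolding A_def J_def b_def by (rule central_config_unplane[OF cc n])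
  have q_diff: "q t - primary a j t = plane (cis t * b j + u t)" for t j
    by (simp add: q_def primary_plane b_def linear_diff[OF linear_unplane] linear_diff[OF linear_plane]
        linear_add[OF linear_plane] algebra_simps)
  have b1: "b 1 = 0" by (simp add: b_def linear_0[OF linear_unplane])
  have nz': "cis t * b j + u t \<noteq> 0" if "j \<in> {1..n}" for t j
  proof (cases "j = 1")
    case True
    then show ?thesis using b1 u0 by simp
  next
    case False
    have "cis t * b j + u t = cis t * (b j + cis (- t) * u t)"
      by (simp add: distrib_left mult.assoc[symmetric] cis_mult)
    then show ?thesis using nz[of j t] False that by (simp add: J_def)
  qed
  have dcis: "(cis has_vector_derivative \<i> * cis t) (at t)" for t
    unfolding has_vector_derivative_complex_iff
    by (auto simp flip: has_real_derivative_iff_has_vector_derivative intro!: derivative_eq_intros)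
  have q_eq: "q = (\<lambda>t. plane (cis t * A + u t))"
    by (auto simp: q_def primary_plane A_def linear_add[OF linear_plane])
  have dq: "(q has_vector_derivative v t) (at t)" for t
    unfolding q_eq v_def
    by (intro bounded_linear.has_vector_derivative[OF bounded_linear_plane]) (auto intro!: derivative_eq_intros dcis du)
  have dv: "(v has_vector_derivative - (\<Sum>j\<in>{1..n}. (m j / norm (q t - primary a j t) powr (\<alpha> + 1)) *\<^sub>R (q t - primary a j t))) (at t)" for t
  proof -
    have tid: "cis t * tidal \<alpha> m b J (cis (- t) * u t) = - (\<Sum>j\<in>J. m j *\<^sub>R grav \<alpha> (cis t * b j + u t)) + cis t * A"
    proof -
      have "cis t * (m j *\<^sub>R (grav \<alpha> (b j + cis (- t) * u t) - grav \<alpha> (b j)))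
        = m j *\<^sub>R grav \<alpha> (cis t * b j + u t) - cis t * (m j *\<^sub>R grav \<alpha> (b j))" for j
        using grav_cis_mult[of \<alpha> t "b j + cis (- t) * u t"]
        by (simp add: distrib_left right_diff_distrib scaleR_diff_right mult.assoc[symmetric] cis_mult)
      then show ?thesis
        by (simp add: tidal_def A sum_distrib_left sum_subtractf)
    qed
    have "(v has_vector_derivative plane (- cis t * A + (- grav \<alpha> (u t) + cis t * tidal \<alpha> m b J (cis (- t) * u t)))) (at t)"
      unfolding v_def
      by (intro bounded_linear.has_vector_derivative[OF bounded_linear_plane])
        (auto intro!: derivative_eq_intros dcis du' simp: mult.assoc[symmetric])
    also have "plane (- cis t * A + (- grav \<alpha> (u t) + cis t * tidal \<alpha> m b J (cis (- t) * u t)))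
        = plane (- (grav \<alpha> (u t) + (\<Sum>j\<in>J. m j *\<^sub>R grav \<alpha> (cis t * b j + u t))))"
      unfolding tid by (simp add: algebra_simps)
    \<comment> \<open>The attraction of the first primary is the missing summand
      \<open>j = 1\<close>, because \<open>b 1 = 0\<close> and \<open>m 1 = 1\<close>.\<close>
    also have "grav \<alpha> (u t) + (\<Sum>j\<in>J. m j *\<^sub>R grav \<alpha> (cis t * b j + u t)) = (\<Sum>j\<in>{1..n}. m j *\<^sub>R grav \<alpha> (cis t * b j + u t))"
      unfolding J_def using n m1 b1 by (subst sum.remove[of "{1..n}" 1]) auto
    also have "plane (- \<dots>) = - (\<Sum>j\<in>{1..n}. m j *\<^sub>R grav \<alpha> (q t - primary a j t))"
      unfolding q_diff by (simp add: grav_plane linear_neg[OF linear_plane] linear_sum[OF linear_plane] linear_cmul[OF linear_plane])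
    finally show ?thesis by (simp add: grav_def)
  qed
  have "q t \<noteq> primary a j t" if "j \<in> {1..n}" for t j
  proof
    assume "q t = primary a j t"
    then have "norm (plane (cis t * b j + u t)) = 0" using q_diff[of t j] by simp
    then show False using nz'[OF that] by simp
  qed
  then have "restricted_solution n m \<alpha> (primary a) q"
    unfolding restricted_solution_def using dq dv by blast
  then show ?thesis by (simp only: q_def[abs_def])
qed

theorem theorem4:
  fixes n :: nat and m :: "nat \<Rightarrow> real" and a :: "nat \<Rightarrow> real^2" and \<alpha> :: real
  assumes "n \<ge> 2"
    and "\<forall>j\<in>{1..n}. m j > 0"
    and "m 1 = 1"
    and "\<alpha> \<ge> 1" and "\<alpha> \<noteq> 2"
    and "inj_on a {1..n}"
    and "central_config n m \<alpha> a"
  shows "\<forall>qq::nat. qq > 0 \<longrightarrow>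
    (\<exists>r0::int. \<exists>C::real. \<forall>r::int. r > r0 \<longrightarrow>
      (\<exists>\<theta>1 \<theta>2 :: real. \<exists>x1 x2 :: real \<Rightarrow> real^2.
         \<theta>1 \<in> {0..2*pi} \<and> \<theta>2 \<in> {0..2*pi} \<and> x1 \<noteq> x2 \<and>
         restricted_solution n m \<alpha> (primary a) x1 \<and>
         restricted_solution n m \<alpha> (primary a) x2 \<and>
         (\<forall>t. x1 (t + 2*pi*real qq) = x1 t) \<and>
         (\<forall>t. x2 (t + 2*pi*real qq) = x2 t) \<and>
         (\<forall>t. norm (x1 t - primary a 1 t
              - ((real_of_int r / real qq) powr (-2/(\<alpha>+1))) *\<^sub>R
                (expJ (\<theta>1 + real_of_int r * t / real qq) *v x0))
            \<le> C * ((real_of_int r / real qq) powr (-2/(\<alpha>+1))) ^ 3) \<and>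
         (\<forall>t. norm (x2 t - primary a 1 t
              - ((real_of_int r / real qq) powr (-2/(\<alpha>+1))) *\<^sub>R
                (expJ (\<theta>2 + real_of_int r * t / real qq) *v x0))
            \<le> C * ((real_of_int r / real qq) powr (-2/(\<alpha>+1))) ^ 3)))"
proof (intro allI impI, goal_cases)
  case (1 qq)
  then have qq: "qq > 0" .
  define b where "b = (\<lambda>j. unplane (a 1 - a j))"
  define J where "J = {1..n} - {1}"
  have "finite J" by (simp add: J_def)
  have b_nz: "b j \<noteq> 0" if "j \<in> J" for j
  proof
    assume "b j = 0"
    then have "plane (b j) = 0" by (simp add: linear_0[OF linear_plane])
    then have "a 1 = a j" by (simp add: b_def)
    then have "1 = j"
      using inj_onD[OF assms(6), of 1 j] that \<open>n \<ge> 2\<close> by (auto simp: J_def)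
    then show False using that by (simp add: J_def)
  qed
  obtain C \<omega>0 :: real where "\<omega>0 \<ge> 1" and orbits:
    "\<And>\<omega> \<epsilon>. \<omega> > \<omega>0 \<Longrightarrow> \<epsilon> = \<omega> powr (- 2 / (\<alpha> + 1)) \<Longrightarrow>
      \<exists>z. (\<forall>s. z (s + 2 * pi) = z s) \<and> (\<forall>s. norm (z s - 1) \<le> 1 / 2) \<and> (\<forall>s. norm (z s - 1) \<le> C * \<epsilon>\<^sup>2) \<and>
        (\<forall>\<theta>. (\<forall>t. satellite_path \<omega> \<epsilon> z \<theta> t \<noteq> 0) \<and>
          (\<forall>t. \<forall>j\<in>J. b j + cis (- t) * satellite_path \<omega> \<epsilon> z \<theta> t \<noteq> 0) \<and>
          (\<exists>u'. \<forall>t. (satellite_path \<omega> \<epsilon> z \<theta> has_vector_derivative u' t) (at t) \<and>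
            (u' has_vector_derivative - grav \<alpha> (satellite_path \<omega> \<epsilon> z \<theta> t)
              + cis t * tidal \<alpha> m b J (cis (- t) * satellite_path \<omega> \<epsilon> z \<theta> t)) (at t)))"
  proof (rule satellite_orbits[where m = m and b = b, OF \<open>\<alpha> \<ge> 1\<close> \<open>\<alpha> \<noteq> 2\<close> \<open>finite J\<close> b_nz], goal_cases)
    case (2 C \<omega>0)
    show thesis by (rule 2(1)) (fact 2(2-3))+
  qed
  show ?case
  proof (rule exI[of _ "\<lceil>\<omega>0 * real qq\<rceil>"], rule exI[of _ C], intro allI impI, goal_cases)
    case (1 r)
    then have "\<omega>0 * real qq < r" by linarith
    define \<omega> where "\<omega> = real_of_int r / real qq"
    define \<epsilon> where "\<epsilon> = \<omega> powr (- 2 / (\<alpha> + 1))"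
    have "\<omega> > \<omega>0" using \<open>\<omega>0 * real qq < r\<close> qq by (simp add: \<omega>_def field_simps)
    then have "\<epsilon> > 0" using \<open>\<omega>0 \<ge> 1\<close> by (simp add: \<epsilon>_def)
    obtain z where per: "\<And>s. z (s + 2 * pi) = z s" and half: "\<And>s. norm (z s - 1) \<le> 1 / 2"
      and bound: "\<And>s. norm (z s - 1) \<le> C * \<epsilon>\<^sup>2"
      and sol: "\<And>\<theta>. (\<forall>t. satellite_path \<omega> \<epsilon> z \<theta> t \<noteq> 0) \<and>
          (\<forall>t. \<forall>j\<in>J. b j + cis (- t) * satellite_path \<omega> \<epsilon> z \<theta> t \<noteq> 0) \<and>
          (\<exists>u'. \<forall>t. (satellite_path \<omega> \<epsilon> z \<theta> has_vector_derivative u' t) (at t) \<and>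
            (u' has_vector_derivative - grav \<alpha> (satellite_path \<omega> \<epsilon> z \<theta> t)
              + cis t * tidal \<alpha> m b J (cis (- t) * satellite_path \<omega> \<epsilon> z \<theta> t)) (at t))"
      using orbits[OF \<open>\<omega> > \<omega>0\<close> \<epsilon>_def] by blast
    define u where "u = satellite_path \<omega> \<epsilon> z"
    define x where "x \<theta> t = primary a 1 t + plane (u \<theta> t)" for \<theta> t
    have solution: "restricted_solution n m \<alpha> (primary a) (x \<theta>)" for \<theta>
    proof -
      obtain u' where u: "\<And>t. u \<theta> t \<noteq> 0" "\<And>t j. j \<in> J \<Longrightarrow> b j + cis (- t) * u \<theta> t \<noteq> 0"
        "\<And>t. (u \<theta> has_vector_derivative u' t) (at t)"
        "\<And>t. (u' has_vector_derivative - grav \<alpha> (u \<theta> t) + cis t * tidal \<alpha> m b J (cis (- t) * u \<theta> t)) (at t)"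
        using sol[of \<theta>] unfolding u_def by blast
      show ?thesis
        unfolding x_def[abs_def]
        by (rule restricted_solution_plane[OF assms(1,3,7) u[unfolded b_def J_def]])
    qed
    have periodic: "x \<theta> (t + 2 * pi * real qq) = x \<theta> t" for \<theta> t
    proof -
      \<comment> \<open>During \<open>qq\<close> revolutions of the primaries the phase advances by
        \<open>r\<close> full turns in the inertial frame and by \<open>r - qq\<close> in the
        rotating one; both numbers are integers.\<close>
      have "\<omega> * (t + 2 * pi * real qq) + \<theta> = \<omega> * t + \<theta> + 2 * pi * of_int r"
        "(\<omega> - 1) * (t + 2 * pi * real qq) + \<theta> = (\<omega> - 1) * t + \<theta> + 2 * pi * of_int (r - int qq)"
        using qq by (simp_all add: \<omega>_def field_simps)
      then have "u \<theta> (t + 2 * pi * real qq) = u \<theta> t"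
        by (simp only: u_def satellite_path_def periodic_int_multiple[of z, OF per] cis_int_multiple)
      then show ?thesis
        using cis_int_multiple[of t "int qq"] by (simp add: x_def primary_plane)
    qed
    have close: "norm (x \<theta> t - primary a 1 t - \<epsilon> *\<^sub>R (expJ (\<theta> + real_of_int r * t / real qq) *v x0)) \<le> C * \<epsilon> ^ 3" for \<theta> t
    proof -
      have "\<theta> + real_of_int r * t / real qq = \<omega> * t + \<theta>" by (simp add: \<omega>_def)
      then have "x \<theta> t - primary a 1 t - \<epsilon> *\<^sub>R (expJ (\<theta> + real_of_int r * t / real qq) *v x0)
          = plane (\<epsilon> *\<^sub>R (cis (\<omega> * t + \<theta>) * (z ((\<omega> - 1) * t + \<theta>) - 1)))"
        by (simp add: x_def u_def satellite_path_def x0_plane expJ_plane linear_diff[OF linear_plane] linear_cmul[OF linear_plane] algebra_simps)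
      also have "norm \<dots> = \<epsilon> * norm (z ((\<omega> - 1) * t + \<theta>) - 1)"
        using \<open>\<epsilon> > 0\<close> by (simp add: norm_mult)
      also have "\<dots> \<le> \<epsilon> * (C * \<epsilon>\<^sup>2)"
        using \<open>\<epsilon> > 0\<close> bound by (intro mult_left_mono) auto
      finally show ?thesis by (simp add: power3_eq_cube power2_eq_square mult_ac)
    qed
    \<comment> \<open>At time 0 the two satellites are near opposite points of the small circle.
      Coincidence would mean \<open>z 0 + z pi = 0\<close>, although both values lie within
      \<open>1 / 2\<close> of 1.\<close>
    have "x 0 \<noteq> x pi"
    proof
      assume "x 0 = x pi"
      then have "norm (plane (u 0 0) - plane (u pi 0)) = 0" by (metis x_def add_left_cancel diff_self norm_zero)
      then have "u 0 0 = u pi 0" by (simp flip: linear_diff[OF linear_plane])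
      then have "\<epsilon> *\<^sub>R (z 0 + z pi) = 0" by (simp add: u_def satellite_path_def scaleR_add_right)
      then have "z 0 + z pi = 0" using \<open>\<epsilon> > 0\<close> by simp
      then have "2 = - ((z 0 - 1) + (z pi - 1))" by (simp add: algebra_simps)
      then have "norm (2::complex) \<le> norm (z 0 - 1) + norm (z pi - 1)"
        by (metis norm_minus_cancel norm_triangle_ineq)
      then show False using half[of 0] half[of pi] by simp
    qed
    then show ?case
      unfolding \<omega>_def[symmetric] \<epsilon>_def[symmetric]
      by (intro exI[of _ 0] exI[of _ pi] exI[of _ "x 0"] exI[of _ "x pi"] conjI allI solution periodic close) auto
  qed
qed

end
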